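(* Let $n\ge2$ and $x\in[0,1[$. Then $C^*_{\rho_x}(V_n)=\pi_x(\mathcal{O}_n)$, where $C^*_{\rho_x}(V_n)=\overline{\mathrm{span}\{\rho_x(g):g\in V_n\}}^{\|\cdot\|}\subseteq B(H_x)$.
   Context: $f(y)=ny\bmod1$ on $[0,1[$; $\mathrm{orb}(x)=\{y\in[0,1[:\ f^p(y)=f^q(x)\text{ for some }p,q\in\mathbb{N}\}$; $H_x=\ell^2(\mathrm{orb}(x))$ with orthonormal basis $\{\delta_y\}$; $S_i\delta_y=\delta_{(y+i-1)/n}$; $\pi_x:\mathcal{O}_n\to B(H_x)$ is the representation of the Cuntz algebra ($\sum_j s_js_j^*=1$, $s_i^*s_j=\delta_{ij}1$) with $\pi_x(s_i)=S_i$, so $\pi_x(\mathcal{O}_n)$ is the C*-algebra generated by $S_1,\dots,S_n$. For a word $u=u_1\cdots u_r$, $\phi(u)=\big[\sum_i\frac{u_i-1}{n^i},\sum_i\frac{u_i-1}{n^i}+n^{-r}\big[$ and $s_u=s_{u_1}\cdots s_{u_r}$. $V_n$ is the group of bijections $g$ of $[0,1[$ for which there are admissible languages (finite sets of words over $\{1,\dots,n\}$ such that every infinite word has exactly one of them as prefix) $\{a_1,\dots,a_r\}$, $\{b_1,\dots,b_r\}$ with $g$ mapping $\phi(b_i)$ onto $\phi(a_i)$ by the increasing affine map; $\Psi_n(g)=\sum_i s_{a_i}s_{b_i}^*$ (independent of the choice), and $\rho_x=\pi_x\circ\Psi_n$, which satisfies $\rho_x(g)\delta_y=\delta_{g(y)}$.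 *)

theory Defs
  imports "HOL-Analysis.Analysis"
begin

definition fmap :: "nat \<Rightarrow> real \<Rightarrow> real" where
  "fmap n y = frac (real n * y)"

definition orb :: "nat \<Rightarrow> real \<Rightarrow> real set" where
  "orb n x = {y \<in> {0..<1}. \<exists>p q. (fmap n ^^ p) y = (fmap n ^^ q) x}"

text \<open>Vectors of l2(X) are functions real => complex vanishing off X and square-summable;
 operators are maps on such functions, required to be zero on non-l2 arguments (extensional),
 so that equality of operators is equality of functions.\<close>

type_synonym vec = "real \<Rightarrow> complex"
type_synonym oper = "vec \<Rightarrow> vec"

definition l2 :: "real set \<Rightarrow> vec set" where
  "l2 X = {v. (\<forall>y. y \<notin> X \<longrightarrow> v y = 0) \<and> (\<lambda>y. (cmod (v y))\<^sup>2) summable_on X}"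

definition l2norm :: "real set \<Rightarrow> vec \<Rightarrow> real" where
  "l2norm X v = sqrt (infsum (\<lambda>y. (cmod (v y))\<^sup>2) X)"

definition l2inner :: "real set \<Rightarrow> vec \<Rightarrow> vec \<Rightarrow> complex" where
  "l2inner X v w = infsum (\<lambda>y. v y * cnj (w y)) X"

definition delta :: "real \<Rightarrow> vec" where
  "delta y = (\<lambda>z. if z = y then 1 else 0)"

definition bop :: "real set \<Rightarrow> oper set" where
  "bop X = {T. (\<forall>v \<in> l2 X. T v \<in> l2 X)
             \<and> (\<forall>v \<in> l2 X. \<forall>w \<in> l2 X. \<forall>(c::complex) a. T (\<lambda>y. c * v y + a * w y) = (\<lambda>y. c * T v y + a * T w y))
             \<and> (\<exists>K. \<forall>v \<in> l2 X. l2norm X (T v) \<le> K * l2norm X v)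
             \<and> (\<forall>v. v \<notin> l2 X \<longrightarrow> T v = (\<lambda>_. 0))}"

definition opnorm :: "real set \<Rightarrow> oper \<Rightarrow> real" where
  "opnorm X T = Sup {l2norm X (T v) | v. v \<in> l2 X \<and> l2norm X v \<le> 1}"

definition adj :: "real set \<Rightarrow> oper \<Rightarrow> oper" where
  "adj X T = (THE A. A \<in> bop X \<and> (\<forall>v \<in> l2 X. \<forall>w \<in> l2 X. l2inner X (T v) w = l2inner X v (A w)))"

definition idop :: "real set \<Rightarrow> oper" where
  "idop X = (\<lambda>v. if v \<in> l2 X then v else (\<lambda>_. 0))"

definition opclosure :: "real set \<Rightarrow> oper set \<Rightarrow> oper set" where
  "opclosure X A = {T \<in> bop X. \<forall>e>0. \<exists>B\<in>A. opnorm X (\<lambda>v. T v - B v) < e}"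

definition lspan :: "oper set \<Rightarrow> oper set" where
  "lspan A = {T. \<exists>k (c::nat \<Rightarrow> complex) B. (\<forall>i<k. B i \<in> A) \<and> T = (\<lambda>v y. \<Sum>i<k. c i * B i v y)}"

definition cstar_gen :: "real set \<Rightarrow> oper set \<Rightarrow> oper set" where
  "cstar_gen X G = \<Inter> {A. G \<subseteq> A \<and> A \<subseteq> bop X
      \<and> (\<forall>S\<in>A. \<forall>T\<in>A. (\<lambda>v y. S v y + T v y) \<in> A)
      \<and> (\<forall>S\<in>A. \<forall>c::complex. (\<lambda>v y. c * S v y) \<in> A)
      \<and> (\<forall>S\<in>A. \<forall>T\<in>A. S \<circ> T \<in> A)
      \<and> (\<forall>S\<in>A. adj X S \<in> A)
      \<and> opclosure X A \<subseteq> A}"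

text \<open>S_i delta_y = delta_((y+i-1)/n), i.e. (S_i v)(z) = v(nz-i+1) for z in orb(x) \<inter> [(i-1)/n, i/n[.\<close>
definition Sop :: "nat \<Rightarrow> real \<Rightarrow> nat \<Rightarrow> oper" where
  "Sop n x i = (\<lambda>v. if v \<in> l2 (orb n x) then
       (\<lambda>z. if z \<in> orb n x \<and> (real i - 1) / real n \<le> z \<and> z < real i / real n
            then v (real n * z - (real i - 1)) else 0)
     else (\<lambda>_. 0))"

definition Sword :: "nat \<Rightarrow> real \<Rightarrow> nat list \<Rightarrow> oper" where
  "Sword n x u = foldr (\<lambda>i T. Sop n x i \<circ> T) u (idop (orb n x))"

definition word :: "nat \<Rightarrow> nat list \<Rightarrow> bool" where
  "word n u \<longleftrightarrow> set u \<subseteq> {1..n}"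

definition phil :: "nat \<Rightarrow> nat list \<Rightarrow> real" where
  "phil n u = (\<Sum>i<length u. (real (u ! i) - 1) / real n ^ (i + 1))"

definition phi :: "nat \<Rightarrow> nat list \<Rightarrow> real set" where
  "phi n u = {phil n u ..< phil n u + 1 / real n ^ length u}"

definition is_prefix :: "nat list \<Rightarrow> (nat \<Rightarrow> nat) \<Rightarrow> bool" where
  "is_prefix u w \<longleftrightarrow> (\<forall>i<length u. u ! i = w i)"

definition admissible :: "nat \<Rightarrow> nat list set \<Rightarrow> bool" where
  "admissible n L \<longleftrightarrow> finite L \<and> (\<forall>u\<in>L. word n u)
     \<and> (\<forall>w. (\<forall>k. w k \<in> {1..n}) \<longrightarrow> (\<exists>!u. u \<in> L \<and> is_prefix u w))"

definition V_witness :: "nat \<Rightarrow> (real \<Rightarrow> real) \<Rightarrow> nat list list \<Rightarrow> nat list list \<Rightarrow> bool" where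
  "V_witness n g a b \<longleftrightarrow> length a = length b \<and> distinct a \<and> distinct b
     \<and> admissible n (set a) \<and> admissible n (set b)
     \<and> (\<forall>i<length a. \<forall>y\<in>phi n (b ! i).
          g y = phil n (a ! i) + (y - phil n (b ! i)) * real n ^ length (b ! i) / real n ^ length (a ! i))"

definition Vn :: "nat \<Rightarrow> (real \<Rightarrow> real) set" where
  "Vn n = {g. bij_betw g {0..<1} {0..<1} \<and> (\<exists>a b. V_witness n g a b)}"

text \<open>rho_x(g) = pi_x(Psi_n(g)) = sum_i S_{a_i} S_{b_i}^* (independent of the choice of a, b).\<close>
definition rho :: "nat \<Rightarrow> real \<Rightarrow> (real \<Rightarrow> real) \<Rightarrow> oper" where
  "rho n x g = (let (a, b) = (SOME (a, b). V_witness n g a b) in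
     (\<lambda>v y. \<Sum>i<length a. (Sword n x (a ! i) \<circ> adj (orb n x) (Sword n x (b ! i))) v y))"

end

theory Submission
  imports Defs
begin

text \<open>
  Write E(u,v) for the partial isometry S_u S_v^*. These operators span a *-algebra whose closure is
  the C*-algebra generated by the S_i, and every rho(g) is a finite sum of them, so it suffices to
  approximate each E(u,v) by linear combinations of the rho(g). Since E(u,v) is the sum of the
  E(ui,vi), both words may be assumed nonempty; then there are arbitrarily large admissible languages
  (a_0,...,a_M) and (b_0,...,b_M) with a_0 = u and b_0 = v. Let g map b_i to a_i for all i, and let g_j
  differ from g by exchanging the targets a_0 and a_j. Then
  rho(g) - 1/M * (rho(g_1) + ... + rho(g_M)) differs from E(u,v) by a combination of the matrix units
  E(a_j,b_k) with Hilbert-Schmidt norm sqrt(3/M), which tends to 0. No exact identity is possible: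
  every combination of the rho(g) multiplies the formal sum of all basis vectors by a scalar, and
  E(u,v) does not.
\<close>

section \<open>Square-summable functions and bounded operators\<close>

text \<open>The triangle inequality does not suffice: the error consists of 3M operators E(a_j,b_k)
  with coefficients of modulus 1/M, so it would give only the bound 3. The gain comes from
  orthogonality. The ranges belong to disjoint cylinders and so do the sources, hence the error
  behaves like its coefficient matrix and is controlled by the square sum of the entries, 3M times
  1/M^2. The part of the diagonal shared by g and all g_j cancels because the coefficients 1 and M
  times -1/M add up to zero. Both words must be nonempty because the only admissible language
  containing the empty word is the singleton. The two languages must also have equal size; every
  size 1 + K(n-1) with K at least the length of the given word occurs, so one large K serves both
  words. On the operator side, S_u, S_u^* and E(u,v) all come from injections between subsets of the
  orbit, so products and adjoints are computed by composing and inverting maps and intersecting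
  domains.\<close>

lemma l2_zero_off: "v \<in> l2 X \<Longrightarrow> y \<notin> X \<Longrightarrow> v y = 0"
  by (auto simp: l2_def)

lemma l2norm_nonneg [simp]: "0 \<le> l2norm X v"
  by (simp add: l2norm_def infsum_nonneg)

lemma L2_set_le_l2norm:
  assumes "v \<in> l2 X" "finite F" "F \<subseteq> X"
  shows "L2_set (\<lambda>y. cmod (v y)) F \<le> l2norm X v"
proof -
  have "(\<Sum>y\<in>F. (cmod (v y))\<^sup>2) \<le> infsum (\<lambda>y. (cmod (v y))\<^sup>2) X"
    using assms by (intro finite_sum_le_infsum) (auto simp: l2_def)
  then show ?thesis
    by (simp add: L2_set_def l2norm_def)
qed

lemma sum_norm2_le_l2norm2:
  assumes "v \<in> l2 X" "finite F" "F \<subseteq> X"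
  shows "(\<Sum>y\<in>F. (cmod (v y))\<^sup>2) \<le> (l2norm X v)\<^sup>2"
proof -
  have "(L2_set (\<lambda>y. cmod (v y)) F)\<^sup>2 \<le> (l2norm X v)\<^sup>2"
    by (intro power_mono L2_set_le_l2norm assms L2_set_nonneg)
  then show ?thesis
    by (simp add: L2_set_def sum_nonneg)
qed

text \<open>Uniform bounds on finite sections give square-summability and the norm bound at once, so
  later estimates reduce to the finite Minkowski and Cauchy-Schwarz inequalities for
  \<open>L2_set\<close>.\<close>

lemma l2_boundI:
  assumes "\<And>y. y \<notin> X \<Longrightarrow> v y = 0"
    and "\<And>F. finite F \<Longrightarrow> F \<subseteq> X \<Longrightarrow> L2_set (\<lambda>y. cmod (v y)) F \<le> K"
  shows "v \<in> l2 X" and "l2norm X v \<le> K"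
proof -
  have K: "0 \<le> K"
    using assms(2)[of "{}"] by simp
  have fin: "(\<Sum>y\<in>F. (cmod (v y))\<^sup>2) \<le> K\<^sup>2" if "finite F" "F \<subseteq> X" for F
  proof -
    have "(L2_set (\<lambda>y. cmod (v y)) F)\<^sup>2 \<le> K\<^sup>2"
      by (intro power_mono assms(2) that L2_set_nonneg)
    then show ?thesis
      by (simp add: L2_set_def sum_nonneg)
  qed
  have summ: "(\<lambda>y. (cmod (v y))\<^sup>2) summable_on X"
    by (rule nonneg_bdd_above_summable_on) (auto intro!: bdd_aboveI2 fin)
  then show "v \<in> l2 X"
    using assms(1) by (auto simp: l2_def)
  have "infsum (\<lambda>y. (cmod (v y))\<^sup>2) X \<le> K\<^sup>2"
    by (rule infsum_le_finite_sums[OF summ]) (use fin in auto)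
  then show "l2norm X v \<le> K"
    using K by (simp add: l2norm_def real_le_lsqrt infsum_nonneg)
qed

lemma l2_scale:
  assumes "v \<in> l2 X"
  shows "(\<lambda>y. c * v y) \<in> l2 X" and "l2norm X (\<lambda>y. c * v y) \<le> cmod c * l2norm X v"
proof -
  have "L2_set (\<lambda>y. cmod (c * v y)) F \<le> cmod c * l2norm X v" if "finite F" "F \<subseteq> X" for F
    using L2_set_le_l2norm[OF assms that]
    by (simp add: norm_mult L2_set_right_distrib[symmetric] mult_left_mono)
  note * = this
  show "(\<lambda>y. c * v y) \<in> l2 X" "l2norm X (\<lambda>y. c * v y) \<le> cmod c * l2norm X v"
    using l2_boundI[of X "\<lambda>y. c * v y", OF _ *] l2_zero_off[OF assms] by simp_all
qed

lemma l2_add: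
  assumes "v \<in> l2 X" "w \<in> l2 X"
  shows "(\<lambda>y. v y + w y) \<in> l2 X" and "l2norm X (\<lambda>y. v y + w y) \<le> l2norm X v + l2norm X w"
proof -
  have *: "L2_set (\<lambda>y. cmod (v y + w y)) F \<le> l2norm X v + l2norm X w" if "finite F" "F \<subseteq> X" for F
  proof -
    have "L2_set (\<lambda>y. cmod (v y + w y)) F \<le> L2_set (\<lambda>y. cmod (v y) + cmod (w y)) F"
      by (intro L2_set_mono norm_triangle_ineq) auto
    also have "\<dots> \<le> L2_set (\<lambda>y. cmod (v y)) F + L2_set (\<lambda>y. cmod (w y)) F"
      by (rule L2_set_triangle_ineq)
    also have "\<dots> \<le> l2norm X v + l2norm X w"
      by (intro add_mono L2_set_le_l2norm assms that)
    finally show ?thesis .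
  qed
  show "(\<lambda>y. v y + w y) \<in> l2 X" "l2norm X (\<lambda>y. v y + w y) \<le> l2norm X v + l2norm X w"
    using l2_boundI[of X "\<lambda>y. v y + w y", OF _ *] assms[THEN l2_zero_off] by simp_all
qed

lemma l2_lincomb: "v \<in> l2 X \<Longrightarrow> w \<in> l2 X \<Longrightarrow> (\<lambda>y. c * v y + a * w y) \<in> l2 X"
  by (intro l2_add(1) l2_scale(1))

lemma l2_diff:
  assumes "v \<in> l2 X" "w \<in> l2 X"
  shows "(\<lambda>y. v y - w y) \<in> l2 X"
  using l2_lincomb[OF assms, of 1 "-1"] by simp

lemma l2_finite_support:
  assumes "finite F" "F \<subseteq> X"
  shows "(\<lambda>y. if y \<in> F then u y else 0) \<in> l2 X"
    and "l2norm X (\<lambda>y. if y \<in> F then u y else 0) \<le> L2_set (\<lambda>y. cmod (u y)) F"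
proof -
  have *: "L2_set (\<lambda>y. cmod (if y \<in> F then u y else 0)) G \<le> L2_set (\<lambda>y. cmod (u y)) F" if "finite G" for G
  proof -
    have "(\<Sum>y\<in>G. (cmod (if y \<in> F then u y else 0))\<^sup>2) = (\<Sum>y\<in>G \<inter> F. (cmod (u y))\<^sup>2)"
      using that by (subst sum.inter_restrict) (auto intro!: sum.cong)
    also have "\<dots> \<le> (\<Sum>y\<in>F. (cmod (u y))\<^sup>2)"
      using assms by (intro sum_mono2) auto
    finally show ?thesis
      by (simp add: L2_set_def)
  qed
  show "(\<lambda>y. if y \<in> F then u y else 0) \<in> l2 X"
    using assms * by (intro l2_boundI(1)[where K="L2_set (\<lambda>y. cmod (u y)) F"]) auto
  show "l2norm X (\<lambda>y. if y \<in> F then u y else 0) \<le> L2_set (\<lambda>y. cmod (u y)) F"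
    using assms * by (intro l2_boundI(2)) auto
qed

lemma l2_zero [simp]: "(\<lambda>_. 0) \<in> l2 X" and l2norm_zero [simp]: "l2norm X (\<lambda>_. 0) = 0"
  by (auto simp: l2_def l2norm_def)

lemma l2_sum:
  assumes "finite F" "\<And>i. i \<in> F \<Longrightarrow> v i \<in> l2 X"
  shows "(\<lambda>z. \<Sum>i\<in>F. c i * v i z) \<in> l2 X"
  using assms by (induction F rule: finite_induct) (auto intro!: l2_add l2_scale)

lemma delta_l2: "y \<in> X \<Longrightarrow> delta y \<in> l2 X"
  using l2_finite_support(1)[of "{y}" X "\<lambda>_. 1"] by (simp add: delta_def)

text \<open>Once the sum of squares over F comes within e^2 of the total, every finite set outside F
  carries at most e^2. The density is used to extend the adjoint identity from finitely supported
  vectors.\<close>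

lemma l2_approx:
  assumes "v \<in> l2 X" "e > 0"
  obtains F where "finite F" "F \<subseteq> X"
    "l2norm X (\<lambda>y. v y - (if y \<in> F then v y else 0)) \<le> e"
proof -
  let ?s = "\<lambda>y. (cmod (v y))\<^sup>2"
  have summ: "?s summable_on X"
    using assms by (auto simp: l2_def)
  obtain F where F: "finite F" "F \<subseteq> X" "infsum ?s X - sum ?s F \<le> e\<^sup>2"
  proof -
    have "\<forall>\<^sub>F F in finite_subsets_at_top X. dist (sum ?s F) (infsum ?s X) < e\<^sup>2"
      using infsum_tendsto[OF summ] assms(2) by (auto simp: tendsto_iff)
    then obtain F where "finite F" "F \<subseteq> X" "dist (sum ?s F) (infsum ?s X) < e\<^sup>2"
      by (auto simp: eventually_finite_subsets_at_top)
    then show ?thesis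
      by (intro that[of F]) (auto simp: dist_real_def)
  qed
  have "L2_set (\<lambda>y. cmod (v y - (if y \<in> F then v y else 0))) G \<le> e" if "finite G" "G \<subseteq> X" for G
  proof -
    have "(\<Sum>y\<in>G. (cmod (v y - (if y \<in> F then v y else 0)))\<^sup>2) = sum ?s (G - F)"
      using that by (intro sum.mono_neutral_cong_right) auto
    also have "\<dots> = sum ?s (G \<union> F) - sum ?s F"
      using that F by (simp add: sum_diff[symmetric] Un_Diff)
    also have "sum ?s (G \<union> F) \<le> infsum ?s X"
      using that F by (intro finite_sum_le_infsum summ) auto
    finally have "(\<Sum>y\<in>G. (cmod (v y - (if y \<in> F then v y else 0)))\<^sup>2) \<le> e\<^sup>2"
      using F by simp
    then show ?thesis
      using assms(2) by (simp add: L2_set_def real_le_lsqrt sum_nonneg)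
  qed
  then have "l2norm X (\<lambda>y. v y - (if y \<in> F then v y else 0)) \<le> e"
    using l2_zero_off[OF assms(1)] by (intro l2_boundI(2)) auto
  with F that show ?thesis by blast
qed

lemma l2inner_summable:
  assumes "v \<in> l2 X" "w \<in> l2 X"
  shows "(\<lambda>y. cmod (v y * cnj (w y))) summable_on X"
    and "cmod (l2inner X v w) \<le> l2norm X v * l2norm X w"
proof -
  have fin: "(\<Sum>y\<in>F. cmod (v y * cnj (w y))) \<le> l2norm X v * l2norm X w" if "finite F" "F \<subseteq> X" for F
  proof -
    have "(\<Sum>y\<in>F. cmod (v y * cnj (w y))) \<le> L2_set (\<lambda>y. cmod (v y)) F * L2_set (\<lambda>y. cmod (w y)) F"
      using L2_set_mult_ineq[of "\<lambda>y. cmod (v y)" "\<lambda>y. cmod (w y)" F] by (simp add: norm_mult)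
    also have "\<dots> \<le> l2norm X v * l2norm X w"
      by (intro mult_mono L2_set_le_l2norm assms that L2_set_nonneg l2norm_nonneg)
    finally show ?thesis .
  qed
  show abs: "(\<lambda>y. cmod (v y * cnj (w y))) summable_on X"
    by (rule nonneg_bdd_above_summable_on) (auto intro!: bdd_aboveI2 fin)
  have "cmod (l2inner X v w) \<le> infsum (\<lambda>y. cmod (v y * cnj (w y))) X"
    unfolding l2inner_def by (rule norm_infsum_bound[OF abs])
  also have "\<dots> \<le> l2norm X v * l2norm X w"
    by (rule infsum_le_finite_sums[OF abs]) (use fin in auto)
  finally show "cmod (l2inner X v w) \<le> l2norm X v * l2norm X w" .
qed

lemma l2inner_lincomb_left:
  assumes "v \<in> l2 X" "w \<in> l2 X" "u \<in> l2 X"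
  shows "l2inner X (\<lambda>y. c * v y + a * w y) u = c * l2inner X v u + a * l2inner X w u"
proof -
  have s: "(\<lambda>y. v y * cnj (u y)) summable_on X" "(\<lambda>y. w y * cnj (u y)) summable_on X"
    using assms by (auto intro: abs_summable_summable l2inner_summable)
  have "l2inner X (\<lambda>y. c * v y + a * w y) u
      = infsum (\<lambda>y. c * (v y * cnj (u y)) + a * (w y * cnj (u y))) X"
    by (simp add: l2inner_def algebra_simps)
  also have "\<dots> = c * l2inner X v u + a * l2inner X w u"
    using s by (simp add: infsum_add summable_on_cmult_right infsum_cmult_right l2inner_def)
  finally show ?thesis .
qed

lemma l2inner_commute: "l2inner X v w = cnj (l2inner X w v)"
  by (simp add: l2inner_def infsum_cnj[symmetric] mult.commute)

lemma l2inner_lincomb_right: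
  assumes "v \<in> l2 X" "w \<in> l2 X" "u \<in> l2 X"
  shows "l2inner X u (\<lambda>y. c * v y + a * w y) = cnj c * l2inner X u v + cnj a * l2inner X u w"
  by (subst (1 2 3) l2inner_commute) (simp add: l2inner_lincomb_left assms)

lemma l2inner_delta: "y \<in> X \<Longrightarrow> l2inner X v (delta y) = v y"
  unfolding l2inner_def
  by (subst infsum_cong_neutral[where T="{y}" and g="\<lambda>y. v y * cnj (delta y y)"]) (auto simp: delta_def)

section \<open>Algebra of bounded operators\<close>

lemma bopD:
  assumes "T \<in> bop X"
  shows bop_l2: "v \<in> l2 X \<Longrightarrow> T v \<in> l2 X"
    and bop_lincomb: "v \<in> l2 X \<Longrightarrow> w \<in> l2 X \<Longrightarrow> T (\<lambda>y. c * v y + a * w y) = (\<lambda>y. c * T v y + a * T w y)"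
    and bop_ext: "v \<notin> l2 X \<Longrightarrow> T v = (\<lambda>_. 0)"
  using assms by (auto simp: bop_def)

lemma bop_bound:
  assumes "T \<in> bop X"
  obtains K where "0 \<le> K" "\<And>v. v \<in> l2 X \<Longrightarrow> l2norm X (T v) \<le> K * l2norm X v"
proof -
  obtain K where K: "\<forall>v \<in> l2 X. l2norm X (T v) \<le> K * l2norm X v"
    using assms by (auto simp: bop_def)
  have "l2norm X (T v) \<le> \<bar>K\<bar> * l2norm X v" if "v \<in> l2 X" for v
  proof -
    have "K * l2norm X v \<le> \<bar>K\<bar> * l2norm X v"
      by (intro mult_right_mono) auto
    with K that show ?thesis by force
  qed
  then show ?thesis
    by (intro that[of "\<bar>K\<bar>"]) auto
qed

lemma bopI:
  assumes "\<And>v. v \<in> l2 X \<Longrightarrow> T v \<in> l2 X"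
    and "\<And>v w c a. v \<in> l2 X \<Longrightarrow> w \<in> l2 X \<Longrightarrow> T (\<lambda>y. c * v y + a * w y) = (\<lambda>y. c * T v y + a * T w y)"
    and "\<And>v. v \<in> l2 X \<Longrightarrow> l2norm X (T v) \<le> K * l2norm X v"
    and "\<And>v. v \<notin> l2 X \<Longrightarrow> T v = (\<lambda>_. 0)"
  shows "T \<in> bop X"
  using assms unfolding bop_def by blast

lemma bop_zero_vec: "T \<in> bop X \<Longrightarrow> T (\<lambda>_. 0) = (\<lambda>_. 0)"
  using bop_lincomb[of T X "\<lambda>_. 0" "\<lambda>_. 0" 0 0] by simp

lemma bop_diff_vec:
  "T \<in> bop X \<Longrightarrow> v \<in> l2 X \<Longrightarrow> w \<in> l2 X \<Longrightarrow> T (\<lambda>y. v y - w y) = (\<lambda>y. T v y - T w y)"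
  using bop_lincomb[of T X v w 1 "-1"] by simp

lemma bop_add:
  assumes "S \<in> bop X" "T \<in> bop X"
  shows "(\<lambda>v y. S v y + T v y) \<in> bop X"
proof -
  obtain K L where "0 \<le> K" and K: "\<And>v. v \<in> l2 X \<Longrightarrow> l2norm X (S v) \<le> K * l2norm X v"
    and "0 \<le> L" and L: "\<And>v. v \<in> l2 X \<Longrightarrow> l2norm X (T v) \<le> L * l2norm X v"
    using bop_bound[OF assms(1)] bop_bound[OF assms(2)] by metis
  show ?thesis
  proof (rule bopI[where K="K+L"])
    show "l2norm X (\<lambda>y. S v y + T v y) \<le> (K + L) * l2norm X v" if "v \<in> l2 X" for v
      using l2_add(2)[OF bop_l2[OF assms(1) that] bop_l2[OF assms(2) that]] K[OF that] L[OF that]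
      by (simp add: algebra_simps)
  qed (auto simp: bop_lincomb[OF assms(1)] bop_lincomb[OF assms(2)] algebra_simps
      bop_ext[OF assms(1)] bop_ext[OF assms(2)] intro!: l2_add(1) bop_l2[OF assms(1)] bop_l2[OF assms(2)])
qed

lemma bop_scale:
  assumes "S \<in> bop X"
  shows "(\<lambda>v y. c * S v y) \<in> bop X"
proof -
  obtain K where "0 \<le> K" and K: "\<And>v. v \<in> l2 X \<Longrightarrow> l2norm X (S v) \<le> K * l2norm X v"
    using bop_bound[OF assms(1)] by metis
  show ?thesis
  proof (rule bopI[where K="cmod c * K"])
    show "l2norm X (\<lambda>y. c * S v y) \<le> (cmod c * K) * l2norm X v" if "v \<in> l2 X" for v
    proof -
      have "l2norm X (\<lambda>y. c * S v y) \<le> cmod c * l2norm X (S v)"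
        by (intro l2_scale bop_l2[OF assms] that)
      also have "\<dots> \<le> cmod c * (K * l2norm X v)"
        by (intro mult_left_mono K that) auto
      finally show ?thesis by simp
    qed
  qed (auto simp: bop_lincomb[OF assms(1)] algebra_simps bop_ext[OF assms(1)]
      intro!: l2_scale(1) bop_l2[OF assms(1)])
qed

lemma bop_comp:
  assumes "S \<in> bop X" "T \<in> bop X"
  shows "S \<circ> T \<in> bop X"
proof -
  obtain K L where "0 \<le> K" and K: "\<And>v. v \<in> l2 X \<Longrightarrow> l2norm X (S v) \<le> K * l2norm X v"
    and "0 \<le> L" and L: "\<And>v. v \<in> l2 X \<Longrightarrow> l2norm X (T v) \<le> L * l2norm X v"
    using bop_bound[OF assms(1)] bop_bound[OF assms(2)] by metis
  show ?thesis
  proof (rule bopI[where K="K*L"])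
    show "l2norm X ((S \<circ> T) v) \<le> (K * L) * l2norm X v" if "v \<in> l2 X" for v
    proof -
      have "l2norm X (S (T v)) \<le> K * l2norm X (T v)"
        by (intro K bop_l2[OF assms(2)] that)
      also have "\<dots> \<le> K * (L * l2norm X v)"
        by (intro mult_left_mono L that) fact
      finally show ?thesis by simp
    qed
  qed (auto simp: bop_lincomb[OF assms(1)] bop_lincomb[OF assms(2)] bop_l2[OF assms(2)]
      bop_ext[OF assms(2)] bop_zero_vec[OF assms(1)] intro!: bop_l2[OF assms(1)] bop_l2[OF assms(2)])
qed

lemma bop_diff:
  assumes "S \<in> bop X" "T \<in> bop X"
  shows "(\<lambda>v y. S v y - T v y) \<in> bop X"
  using bop_add[OF assms(1) bop_scale[OF assms(2), of "-1"]] by simp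

lemma bop_idop: "idop X \<in> bop X"
  by (rule bopI[where K=1]) (auto simp: idop_def l2_lincomb)

lemma bop_zero: "(\<lambda>v y. 0) \<in> bop X"
  using bop_scale[OF bop_idop, of 0] by simp

text \<open>The factors 1 keep the sums in the shape of \<open>l2_sum\<close> and
  \<open>lspan_sum\<close>, in which the resolution of the identity is later stated.\<close>

lemma bop_sum_vec:
  assumes T: "T \<in> bop Y" and "finite I" "\<And>i. i \<in> I \<Longrightarrow> f i \<in> l2 Y"
  shows "T (\<lambda>y. \<Sum>i\<in>I. 1 * f i y) = (\<lambda>y. \<Sum>i\<in>I. 1 * T (f i) y)"
  using assms(2,3)
proof (induction I rule: finite_induct)
  case empty
  then show ?case using bop_zero_vec[OF T] by simp
next
  case (insert i I)
  have "T (\<lambda>y. 1 * f i y + 1 * (\<Sum>i\<in>I. 1 * f i y)) = (\<lambda>y. 1 * T (f i) y + 1 * T (\<lambda>y. \<Sum>i\<in>I. 1 * f i y) y)"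
    using insert by (intro bop_lincomb[OF T] l2_sum) auto
  with insert show ?case by simp
qed

lemma idop_comp:
  assumes "T \<in> bop X" shows "idop X \<circ> T = T"
proof
  fix v
  show "(idop X \<circ> T) v = T v"
    using bop_l2[OF assms] bop_ext[OF assms] by (cases "v \<in> l2 X") (auto simp: idop_def)
qed

lemma comp_idop: "T \<in> bop X \<Longrightarrow> T \<circ> idop X = T"
  by (rule ext) (auto simp: idop_def bop_ext bop_zero_vec)

section \<open>Adjoints and norm closures\<close>

text \<open>This is the predicate under the definite description in \<open>adj\<close>. Naming it
  allows an adjoint to be computed by exhibiting a candidate.\<close>

definition is_adj :: "real set \<Rightarrow> oper \<Rightarrow> oper \<Rightarrow> bool" where
  "is_adj X T A \<longleftrightarrow> A \<in> bop X \<and> (\<forall>v \<in> l2 X. \<forall>w \<in> l2 X. l2inner X (T v) w = l2inner X v (A w))"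

text \<open>Pairing with \<open>delta y\<close> recovers every coordinate on X; the remaining values
  vanish by the conventions built into \<open>bop\<close>.\<close>

lemma is_adj_unique:
  assumes "is_adj X T A" "is_adj X T B"
  shows "A = B"
proof (intro ext)
  fix w y
  have bop: "A \<in> bop X" "B \<in> bop X"
    using assms by (auto simp: is_adj_def)
  show "A w y = B w y"
  proof (cases "w \<in> l2 X \<and> y \<in> X")
    case True
    then have "l2inner X (A w) (delta y) = l2inner X (B w) (delta y)"
      using assms by (subst (1 2) l2inner_commute) (metis delta_l2 is_adj_def)
    with True show ?thesis by (simp add: l2inner_delta)
  next
    case False
    then show ?thesis
      using bop by (metis bop_ext bop_l2 l2_zero_off)
  qed
qed

lemma adj_eqI: "is_adj X T A \<Longrightarrow> adj X T = A"
  unfolding adj_def using is_adj_unique by (intro the_equality) (auto simp: is_adj_def)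

lemma bop_finite_sum_delta:
  assumes T: "T \<in> bop X" and F: "finite F" "F \<subseteq> X"
  shows "T (\<lambda>y. if y \<in> F then u y else 0) = (\<lambda>z. \<Sum>y\<in>F. u y * T (delta y) z)"
  using F
proof (induction F rule: finite_induct)
  case empty
  then show ?case using bop_zero_vec[OF T] by simp
next
  case (insert x F)
  have eq: "(\<lambda>y. if y \<in> insert x F then u y else 0) = (\<lambda>y. u x * delta x y + 1 * (if y \<in> F then u y else 0))"
    using insert by (auto simp: delta_def)
  have "T (\<lambda>y. if y \<in> insert x F then u y else 0) = (\<lambda>z. u x * T (delta x) z + 1 * T (\<lambda>y. if y \<in> F then u y else 0) z)"
    unfolding eq using insert by (intro bop_lincomb[OF T] delta_l2 l2_finite_support) auto
  also have "\<dots> = (\<lambda>z. \<Sum>y\<in>insert x F. u y * T (delta y) z)"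
    using insert by auto
  finally show ?case .
qed

lemma l2inner_sum_right:
  assumes "finite F" "\<And>i. i \<in> F \<Longrightarrow> v i \<in> l2 X" "w \<in> l2 X"
  shows "l2inner X w (\<lambda>z. \<Sum>i\<in>F. c i * v i z) = (\<Sum>i\<in>F. cnj (c i) * l2inner X w (v i))"
  using assms
proof (induction F rule: finite_induct)
  case empty
  then show ?case by (simp add: l2inner_def)
next
  case (insert i F)
  then have "l2inner X w (\<lambda>z. c i * v i z + 1 * (\<Sum>i\<in>F. c i * v i z))
      = cnj (c i) * l2inner X w (v i) + cnj 1 * l2inner X w (\<lambda>z. \<Sum>i\<in>F. c i * v i z)"
    by (intro l2inner_lincomb_right l2_sum) auto
  with insert show ?case by simp
qed

text \<open>The matrix of the adjoint is the conjugate transpose; testing it against its own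
  truncations shows that it defines a bounded operator.\<close>
lemma adj_exists:
  assumes T: "T \<in> bop X" and K: "0 \<le> K" "\<And>v. v \<in> l2 X \<Longrightarrow> l2norm X (T v) \<le> K * l2norm X v"
  obtains A where "is_adj X T A" "\<And>v. v \<in> l2 X \<Longrightarrow> l2norm X (A v) \<le> K * l2norm X v"
proof
  define A :: oper where
    "A w = (if w \<in> l2 X then (\<lambda>y. if y \<in> X then l2inner X w (T (delta y)) else 0) else (\<lambda>_. 0))" for w
  have Td: "T (delta y) \<in> l2 X" if "y \<in> X" for y
    using bop_l2[OF T delta_l2[OF that]] .
  have fin: "l2inner X w (T (\<lambda>y. if y \<in> F then u y else 0)) = (\<Sum>y\<in>F. cnj (u y) * A w y)"
    if "w \<in> l2 X" "finite F" "F \<subseteq> X" for w F u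
  proof -
    have "l2inner X w (T (\<lambda>y. if y \<in> F then u y else 0)) = (\<Sum>y\<in>F. cnj (u y) * l2inner X w (T (delta y)))"
      using that Td by (subst bop_finite_sum_delta[OF T]) (auto intro!: l2inner_sum_right)
    also have "\<dots> = (\<Sum>y\<in>F. cnj (u y) * A w y)"
      using that by (intro sum.cong) (auto simp: A_def)
    finally show ?thesis .
  qed
  have bd: "L2_set (\<lambda>y. cmod (A w y)) F \<le> K * l2norm X w" if w: "w \<in> l2 X" and F: "finite F" "F \<subseteq> X" for w F
  proof -
    let ?s = "L2_set (\<lambda>y. cmod (A w y)) F"
    let ?u = "\<lambda>y. if y \<in> F then A w y else 0"
    have u: "?u \<in> l2 X" "l2norm X ?u \<le> ?s"
      using F by (rule l2_finite_support)+
    have "(\<Sum>y\<in>F. cnj (A w y) * A w y) = complex_of_real (\<Sum>y\<in>F. (cmod (A w y))\<^sup>2)"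
      by (simp add: complex_norm_square mult.commute del: of_real_power)
    then have "?s\<^sup>2 = cmod (\<Sum>y\<in>F. cnj (A w y) * A w y)"
      by (simp add: L2_set_def sum_nonneg del: of_real_sum)
    also have "\<dots> = cmod (l2inner X w (T ?u))"
      using fin[OF w F, of "A w"] by simp
    also have "\<dots> \<le> l2norm X w * l2norm X (T ?u)"
      by (intro l2inner_summable w bop_l2[OF T] u)
    also have "\<dots> \<le> l2norm X w * (K * ?s)"
      using K(2)[OF u(1)] mult_left_mono[OF u(2) K(1)] by (intro mult_left_mono) auto
    finally have "?s * ?s \<le> (K * l2norm X w) * ?s"
      by (simp add: power2_eq_square algebra_simps)
    then show ?thesis
      using K(1) by (cases "?s = 0") (auto simp: mult_le_cancel_right less_le)
  qed
  have l2A: "A w \<in> l2 X" "l2norm X (A w) \<le> K * l2norm X w" if "w \<in> l2 X" for w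
    using l2_boundI[of X "A w", OF _ bd[OF that]] by (auto simp: A_def)
  have bopA: "A \<in> bop X"
  proof (rule bopI[where K=K])
    show "A (\<lambda>y. c * v y + a * w y) = (\<lambda>y. c * A v y + a * A w y)" if "v \<in> l2 X" "w \<in> l2 X" for v w c a
      using that by (auto simp: A_def l2_lincomb Td l2inner_lincomb_left)
    show "A w = (\<lambda>_. 0)" if "w \<notin> l2 X" for w
      using that by (simp add: A_def)
  qed (rule l2A; assumption)+
  have inner: "l2inner X (T v) w = l2inner X v (A w)" if v: "v \<in> l2 X" and w: "w \<in> l2 X" for v w
  proof -
    have "cmod (l2inner X (T v) w - l2inner X v (A w)) \<le> e" if "e > 0" for e
    proof -
      \<comment> \<open>The summand 1 keeps the denominator positive when
        \<open>K * l2norm X w\<close> is zero; the factor 2 accounts for the two error terms caused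
        by the remainder \<open>r\<close>.\<close>
      define d where "d = e / (2 * K * l2norm X w + 1)"
      have pos: "2 * K * l2norm X w + 1 > 0"
        using K(1) by (simp add: add_nonneg_pos)
      have d: "d > 0" "2 * K * l2norm X w * d \<le> e"
      proof -
        show "d > 0" using pos that by (simp add: d_def)
        have "2 * K * l2norm X w * d \<le> (2 * K * l2norm X w + 1) * d"
          using \<open>d > 0\<close> by (simp add: algebra_simps)
        also have "\<dots> = e" using pos by (simp add: d_def)
        finally show "2 * K * l2norm X w * d \<le> e" .
      qed
      obtain F where F: "finite F" "F \<subseteq> X"
        and close: "l2norm X (\<lambda>y. v y - (if y \<in> F then v y else 0)) \<le> d"
        using l2_approx[OF v d(1)] by blast
      define u where "u = (\<lambda>y. if y \<in> F then v y else 0)"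
      define r where "r = (\<lambda>y. v y - u y)"
      have u: "u \<in> l2 X" unfolding u_def by (rule l2_finite_support[OF F])
      have r: "r \<in> l2 X" unfolding r_def by (rule l2_diff[OF v u])
      have rd: "l2norm X r \<le> d" using close by (simp add: r_def u_def)
      have "l2inner X (T u) w = cnj (\<Sum>y\<in>F. cnj (v y) * A w y)"
        using fin[OF w F, of v] by (subst l2inner_commute) (simp add: u_def)
      also have "\<dots> = l2inner X u (A w)"
      proof -
        have "l2inner X u (A w) = infsum (\<lambda>y. v y * cnj (A w y)) F"
          unfolding l2inner_def using F by (intro infsum_cong_neutral) (auto simp: u_def)
        then show ?thesis using F by simp
      qed
      finally have eq: "l2inner X (T u) w = l2inner X u (A w)" .
      have "l2inner X (T v) w = l2inner X (\<lambda>y. 1 * T u y + 1 * T r y) w"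
        using bop_diff_vec[OF T v u] by (simp add: r_def)
      also have "\<dots> = l2inner X (T u) w + l2inner X (T r) w"
        by (subst l2inner_lincomb_left) (auto intro!: bop_l2[OF T] u r w)
      finally have 1: "l2inner X (T v) w = l2inner X (T u) w + l2inner X (T r) w" .
      have "l2inner X v (A w) = l2inner X (\<lambda>y. 1 * u y + 1 * r y) (A w)"
        by (simp add: r_def)
      also have "\<dots> = l2inner X u (A w) + l2inner X r (A w)"
        by (subst l2inner_lincomb_left) (auto intro!: l2A u r w)
      finally have 2: "l2inner X v (A w) = l2inner X u (A w) + l2inner X r (A w)" .
      \<comment> \<open>The finitely supported parts agree exactly, so only the remainder
        \<open>r\<close> contributes, once through \<open>T\<close> and once through
        \<open>A\<close>.\<close>
      have "cmod (l2inner X (T v) w - l2inner X v (A w)) = cmod (l2inner X (T r) w - l2inner X r (A w))"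
        by (simp add: 1 2 eq)
      also have "\<dots> \<le> cmod (l2inner X (T r) w) + cmod (l2inner X r (A w))"
        by (rule norm_triangle_ineq4)
      also have "\<dots> \<le> l2norm X (T r) * l2norm X w + l2norm X r * l2norm X (A w)"
        by (intro add_mono l2inner_summable bop_l2[OF T] r w l2A)
      also have "\<dots> \<le> (K * d) * l2norm X w + d * (K * l2norm X w)"
        using K(2)[OF r] mult_left_mono[OF rd K(1)] rd l2A(2)[OF w] d(1) K(1)
        by (intro add_mono mult_mono) auto
      also have "\<dots> \<le> e" using d(2) by (simp add: algebra_simps)
      finally show ?thesis .
    qed
    then have "cmod (l2inner X (T v) w - l2inner X v (A w)) \<le> 0"
      by (rule dense_ge)
    then show ?thesis by simp
  qed
  show "is_adj X T A" using bopA inner by (simp add: is_adj_def)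
  show "\<And>v. v \<in> l2 X \<Longrightarrow> l2norm X (A v) \<le> K * l2norm X v" by (rule l2A)
qed

lemma is_adj_adj:
  assumes "T \<in> bop X" shows "is_adj X T (adj X T)"
proof -
  obtain K where "0 \<le> K" "\<And>v. v \<in> l2 X \<Longrightarrow> l2norm X (T v) \<le> K * l2norm X v"
    using bop_bound[OF assms] by blast
  then obtain A where "is_adj X T A"
    using adj_exists[OF assms, of K] by blast
  then show ?thesis
    using adj_eqI by simp
qed

lemma adj_bop: "T \<in> bop X \<Longrightarrow> adj X T \<in> bop X"
  using is_adj_adj by (auto simp: is_adj_def)

lemma adj_bound:
  assumes "T \<in> bop X" "0 \<le> K" "\<And>v. v \<in> l2 X \<Longrightarrow> l2norm X (T v) \<le> K * l2norm X v" "v \<in> l2 X"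
  shows "l2norm X (adj X T v) \<le> K * l2norm X v"
proof -
  obtain A where "is_adj X T A" "\<And>v. v \<in> l2 X \<Longrightarrow> l2norm X (A v) \<le> K * l2norm X v"
    using adj_exists[OF assms(1-3)] by blast
  then show ?thesis
    using adj_eqI assms(4) by simp
qed

lemma l2inner_adj: "T \<in> bop X \<Longrightarrow> v \<in> l2 X \<Longrightarrow> w \<in> l2 X \<Longrightarrow> l2inner X (T v) w = l2inner X v (adj X T w)"
  using is_adj_adj by (auto simp: is_adj_def)

lemma adj_adj:
  assumes "T \<in> bop X" shows "adj X (adj X T) = T"
proof (rule adj_eqI)
  show "is_adj X (adj X T) T"
    unfolding is_adj_def
  proof (intro conjI ballI assms)
    fix v w assume "v \<in> l2 X" "w \<in> l2 X"
    then have "cnj (l2inner X (T w) v) = cnj (l2inner X w (adj X T v))"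
      using l2inner_adj[OF assms] by simp
    then show "l2inner X (adj X T v) w = l2inner X v (T w)"
      unfolding l2inner_commute[of X "adj X T v" w] l2inner_commute[of X v "T w"] by simp
  qed
qed

lemma adj_comp:
  assumes "S \<in> bop X" "T \<in> bop X" shows "adj X (S \<circ> T) = adj X T \<circ> adj X S"
  by (rule adj_eqI) (use assms in \<open>simp add: is_adj_def bop_comp adj_bop l2inner_adj bop_l2\<close>)

lemma adj_lincomb:
  assumes "S \<in> bop X" "T \<in> bop X"
  shows "adj X (\<lambda>v y. c * S v y + a * T v y) = (\<lambda>v y. cnj c * adj X S v y + cnj a * adj X T v y)"
  by (rule adj_eqI) (use assms in \<open>simp add: is_adj_def bop_add bop_scale adj_bop l2inner_adj bop_l2
        l2inner_lincomb_left l2inner_lincomb_right\<close>)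

lemma adj_idop: "adj X (idop X) = idop X"
  by (rule adj_eqI) (simp add: is_adj_def bop_idop, simp add: idop_def)

section \<open>Operator norm and norm closure\<close>

lemma opnorm_le:
  assumes "0 \<le> K" "\<And>v. v \<in> l2 X \<Longrightarrow> l2norm X (T v) \<le> K * l2norm X v"
  shows "opnorm X T \<le> K"
  unfolding opnorm_def
proof (rule cSup_least)
  show "{l2norm X (T v) |v. v \<in> l2 X \<and> l2norm X v \<le> 1} \<noteq> {}"
    by (auto intro!: exI[of _ "\<lambda>_. 0"])
  fix s assume "s \<in> {l2norm X (T v) |v. v \<in> l2 X \<and> l2norm X v \<le> 1}"
  then obtain v where v: "v \<in> l2 X" "l2norm X v \<le> 1" "s = l2norm X (T v)" by auto
  with assms(2)[OF v(1)] mult_left_mono[OF v(2) assms(1)] show "s \<le> K" by simp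
qed

lemma l2norm_eq_0:
  assumes "v \<in> l2 X" "l2norm X v = 0" shows "v = (\<lambda>_. 0)"
proof
  fix y
  show "v y = 0"
    using L2_set_le_l2norm[OF assms(1), of "{y}"] l2_zero_off[OF assms(1)] assms(2)
    by (cases "y \<in> X") auto
qed

lemma l2norm_le_opnorm:
  assumes T: "T \<in> bop X" and v: "v \<in> l2 X"
  shows "l2norm X (T v) \<le> opnorm X T * l2norm X v"
proof (cases "l2norm X v = 0")
  case True
  then show ?thesis using l2norm_eq_0[OF v] bop_zero_vec[OF T] by auto
next
  case False
  then have pos: "l2norm X v > 0" by (simp add: less_le)
  define r where "r = l2norm X v"
  obtain K where K: "0 \<le> K" "\<And>v. v \<in> l2 X \<Longrightarrow> l2norm X (T v) \<le> K * l2norm X v"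
    using bop_bound[OF T] by blast
  let ?w = "\<lambda>y. complex_of_real (1 / r) * v y"
  have w: "?w \<in> l2 X" "l2norm X ?w \<le> 1"
    using l2_scale[OF v, of "complex_of_real (1/r)"] pos by (auto simp: r_def norm_divide)
  \<comment> \<open>A real supremum bounds its members only if the set is bounded above; the
    operator bound K provides this.\<close>
  have "bdd_above {l2norm X (T v) |v. v \<in> l2 X \<and> l2norm X v \<le> 1}"
  proof (rule bdd_aboveI[of _ K])
    fix s assume "s \<in> {l2norm X (T v) |v. v \<in> l2 X \<and> l2norm X v \<le> 1}"
    then obtain u where u: "u \<in> l2 X" "l2norm X u \<le> 1" "s = l2norm X (T u)" by auto
    with K(2)[OF u(1)] mult_left_mono[OF u(2) K(1)] show "s \<le> K" by simp
  qed
  then have *: "l2norm X (T ?w) \<le> opnorm X T"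
    unfolding opnorm_def using w by (intro cSup_upper) auto
  have "T v = (\<lambda>y. complex_of_real r * T ?w y)"
    using bop_lincomb[OF T w(1) l2_zero, of "complex_of_real r" 0] pos by (simp add: r_def)
  then have "l2norm X (T v) \<le> r * l2norm X (T ?w)"
    using l2_scale(2)[OF bop_l2[OF T w(1)], of "complex_of_real r"] pos by (simp add: r_def)
  also have "\<dots> \<le> r * opnorm X T"
    using * pos by (simp add: r_def)
  finally show ?thesis by (simp add: r_def mult.commute)
qed

text \<open>Trades the supremum in \<open>opnorm\<close> for a non-strict estimate on each vector;
  halving e recovers the strict inequality. The approximation arguments that follow work with this
  form.\<close>

lemma opclosure_iff:
  assumes "A \<subseteq> bop X"
  shows "T \<in> opclosure X A \<longleftrightarrow> T \<in> bop X \<and>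
     (\<forall>e>0. \<exists>B\<in>A. \<forall>v\<in>l2 X. l2norm X (\<lambda>y. T v y - B v y) \<le> e * l2norm X v)" (is "_ \<longleftrightarrow> _ \<and> ?R")
proof (cases "T \<in> bop X")
  case True
  have "?R" if C: "\<And>e. e > 0 \<Longrightarrow> \<exists>B\<in>A. opnorm X (\<lambda>v y. T v y - B v y) < e"
  proof (intro allI impI)
    fix e :: real assume "e > 0"
    then obtain B where B: "B \<in> A" "opnorm X (\<lambda>v y. T v y - B v y) < e" using C by blast
    have "l2norm X (\<lambda>y. T v y - B v y) \<le> e * l2norm X v" if "v \<in> l2 X" for v
    proof -
      have "l2norm X (\<lambda>y. T v y - B v y) \<le> opnorm X (\<lambda>v y. T v y - B v y) * l2norm X v"
        using l2norm_le_opnorm[OF bop_diff[OF True] that, of B] B assms by auto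
      also have "\<dots> \<le> e * l2norm X v" using B by (intro mult_right_mono) auto
      finally show ?thesis .
    qed
    with B show "\<exists>B\<in>A. \<forall>v\<in>l2 X. l2norm X (\<lambda>y. T v y - B v y) \<le> e * l2norm X v" by blast
  qed
  moreover have "\<exists>B\<in>A. opnorm X (\<lambda>v y. T v y - B v y) < e" if R: ?R and e: "e > 0" for e
  proof -
    obtain B where B: "B \<in> A" "\<And>v. v\<in>l2 X \<Longrightarrow> l2norm X (\<lambda>y. T v y - B v y) \<le> (e/2) * l2norm X v"
      using R half_gt_zero[OF e] by meson
    have "opnorm X (\<lambda>v y. T v y - B v y) \<le> e/2"
      using B e by (intro opnorm_le) auto
    with B e show ?thesis by (intro bexI[of _ B]) auto
  qed
  ultimately show ?thesis
    using True unfolding opclosure_def fun_diff_def by blast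
qed (auto simp: opclosure_def)

lemma opclosure_bop: "opclosure X A \<subseteq> bop X"
  by (auto simp: opclosure_def)

lemma opclosure_mono: "A \<subseteq> B \<Longrightarrow> opclosure X A \<subseteq> opclosure X B"
  unfolding opclosure_def by blast

lemma opclosure_superset:
  assumes "A \<subseteq> bop X" shows "A \<subseteq> opclosure X A"
  unfolding opclosure_iff[OF assms, THEN eq_reflection] subset_iff
proof (intro allI impI conjI)
  fix T and e :: real assume "T \<in> A" "e > 0"
  then show "\<exists>B\<in>A. \<forall>v\<in>l2 X. l2norm X (\<lambda>y. T v y - B v y) \<le> e * l2norm X v"
    by (intro bexI[of _ T]) auto
qed (use assms in auto)

lemma l2norm_triangle_diff:
  assumes "u \<in> l2 X" "v \<in> l2 X" "w \<in> l2 X"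
  shows "l2norm X (\<lambda>y. u y - w y) \<le> l2norm X (\<lambda>y. u y - v y) + l2norm X (\<lambda>y. v y - w y)"
  using l2_add(2)[OF l2_diff[OF assms(1,2)] l2_diff[OF assms(2,3)]] by simp

lemma opclosure_idem:
  assumes "A \<subseteq> bop X"
  shows "opclosure X (opclosure X A) \<subseteq> opclosure X A"
proof
  fix T assume T: "T \<in> opclosure X (opclosure X A)"
  then have Tb: "T \<in> bop X" using opclosure_bop by blast
  show "T \<in> opclosure X A"
    unfolding opclosure_iff[OF assms]
  proof (intro conjI Tb allI impI)
    fix e :: real assume e: "e > 0"
    obtain B where B: "B \<in> opclosure X A" "\<And>v. v\<in>l2 X \<Longrightarrow> l2norm X (\<lambda>y. T v y - B v y) \<le> (e/2) * l2norm X v"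
      using T e unfolding opclosure_iff[OF opclosure_bop] by (meson half_gt_zero)
    obtain C where C: "C \<in> A" "\<And>v. v\<in>l2 X \<Longrightarrow> l2norm X (\<lambda>y. B v y - C v y) \<le> (e/2) * l2norm X v"
      using B(1) e unfolding opclosure_iff[OF assms] by (meson half_gt_zero)
    have Bb: "B \<in> bop X" "C \<in> bop X" using B(1) C(1) assms opclosure_bop by blast+
    have "l2norm X (\<lambda>y. T v y - C v y) \<le> e * l2norm X v" if "v \<in> l2 X" for v
      using l2norm_triangle_diff[OF bop_l2[OF Tb that] bop_l2[OF Bb(1) that] bop_l2[OF Bb(2) that]]
        B(2)[OF that] C(2)[OF that] by (simp add: algebra_simps)
    with C show "\<exists>B\<in>A. \<forall>v\<in>l2 X. l2norm X (\<lambda>y. T v y - B v y) \<le> e * l2norm X v" by blast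
  qed
qed

lemma opclosure_add:
  assumes A: "A \<subseteq> bop X" and add: "\<And>S T. S \<in> A \<Longrightarrow> T \<in> A \<Longrightarrow> (\<lambda>v y. S v y + T v y) \<in> A"
    and S: "S \<in> opclosure X A" and T: "T \<in> opclosure X A"
  shows "(\<lambda>v y. S v y + T v y) \<in> opclosure X A"
  unfolding opclosure_iff[OF A]
proof (intro conjI allI impI)
  have Sb: "S \<in> bop X" and Tb: "T \<in> bop X" using S T opclosure_bop by auto
  then show "(\<lambda>v y. S v y + T v y) \<in> bop X" by (rule bop_add)
  fix e :: real assume e: "e > 0"
  obtain B where B: "B \<in> A" "\<And>v. v\<in>l2 X \<Longrightarrow> l2norm X (\<lambda>y. S v y - B v y) \<le> (e/2) * l2norm X v"
    using S e unfolding opclosure_iff[OF A] by (meson half_gt_zero)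
  obtain C where C: "C \<in> A" "\<And>v. v\<in>l2 X \<Longrightarrow> l2norm X (\<lambda>y. T v y - C v y) \<le> (e/2) * l2norm X v"
    using T e unfolding opclosure_iff[OF A] by (meson half_gt_zero)
  have b: "B \<in> bop X" "C \<in> bop X" using A B C by auto
  have "l2norm X (\<lambda>y. (S v y + T v y) - (B v y + C v y)) \<le> e * l2norm X v" if v: "v \<in> l2 X" for v
    using l2_add(2)[OF l2_diff[OF bop_l2[OF Sb v] bop_l2[OF b(1) v]] l2_diff[OF bop_l2[OF Tb v] bop_l2[OF b(2) v]]]
      B(2)[OF v] C(2)[OF v] by (simp add: algebra_simps)
  then show "\<exists>B\<in>A. \<forall>v\<in>l2 X. l2norm X (\<lambda>y. (S v y + T v y) - B v y) \<le> e * l2norm X v"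
    using add[OF B(1) C(1)] by (intro bexI[where x="\<lambda>v y. B v y + C v y"]) auto
qed

lemma opclosure_scale:
  assumes A: "A \<subseteq> bop X" and scale: "\<And>S. S \<in> A \<Longrightarrow> (\<lambda>v y. c * S v y) \<in> A"
    and S: "S \<in> opclosure X A"
  shows "(\<lambda>v y. c * S v y) \<in> opclosure X A"
  unfolding opclosure_iff[OF A]
proof (intro conjI allI impI)
  have Sb: "S \<in> bop X" using S opclosure_bop by auto
  then show "(\<lambda>v y. c * S v y) \<in> bop X" by (rule bop_scale)
  fix e :: real assume e: "e > 0"
  define d where "d = e / (cmod c + 1)"
  have "cmod c + 1 > 0" by (simp add: add_nonneg_pos)
  then have d: "d > 0" "cmod c * d \<le> e" using e by (auto simp: d_def field_simps)
  obtain B where B: "B \<in> A" "\<And>v. v\<in>l2 X \<Longrightarrow> l2norm X (\<lambda>y. S v y - B v y) \<le> d * l2norm X v"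
    using S d(1) unfolding opclosure_iff[OF A] by meson
  have b: "B \<in> bop X" using A B by auto
  have "l2norm X (\<lambda>y. c * S v y - c * B v y) \<le> e * l2norm X v" if v: "v \<in> l2 X" for v
  proof -
    have "l2norm X (\<lambda>y. c * S v y - c * B v y) \<le> cmod c * l2norm X (\<lambda>y. S v y - B v y)"
      using l2_scale(2)[OF l2_diff[OF bop_l2[OF Sb v] bop_l2[OF b v]], of c] by (simp add: algebra_simps)
    also have "\<dots> \<le> cmod c * (d * l2norm X v)"
      by (intro mult_left_mono B v) auto
    also have "\<dots> \<le> e * l2norm X v"
      using mult_right_mono[OF d(2), of "l2norm X v"] by (simp add: mult.assoc)
    finally show ?thesis .
  qed
  then show "\<exists>B\<in>A. \<forall>v\<in>l2 X. l2norm X (\<lambda>y. c * S v y - B v y) \<le> e * l2norm X v"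
    using scale[OF B(1)] by (intro bexI[where x="\<lambda>v y. c * B v y"]) auto
qed

text \<open>Every bound of an operator is also a bound of its adjoint, so adjoints of approximants
  approximate with the same e.\<close>

lemma opclosure_adj:
  assumes A: "A \<subseteq> bop X" and adj: "\<And>S. S \<in> A \<Longrightarrow> adj X S \<in> A" and S: "S \<in> opclosure X A"
  shows "adj X S \<in> opclosure X A"
  unfolding opclosure_iff[OF A]
proof (intro conjI allI impI)
  have Sb: "S \<in> bop X" using S opclosure_bop by auto
  then show "adj X S \<in> bop X" by (rule adj_bop)
  fix e :: real assume e: "e > 0"
  obtain B where B: "B \<in> A" "\<And>v. v\<in>l2 X \<Longrightarrow> l2norm X (\<lambda>y. S v y - B v y) \<le> e * l2norm X v"
    using S e unfolding opclosure_iff[OF A] by meson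
  have b: "B \<in> bop X" using A B by auto
  have "l2norm X (\<lambda>y. adj X S v y - adj X B v y) \<le> e * l2norm X v" if v: "v \<in> l2 X" for v
    using adj_bound[OF bop_diff[OF Sb b] _ B(2) v] adj_lincomb[OF Sb b, of 1 "-1"] e by simp
  then show "\<exists>B\<in>A. \<forall>v\<in>l2 X. l2norm X (\<lambda>y. adj X S v y - B v y) \<le> e * l2norm X v"
    using adj[OF B(1)] by blast
qed

text \<open>With approximants B of S and C of T, the error splits as (S - B) T + B (T - C).\<close>

lemma opclosure_comp:
  assumes A: "A \<subseteq> bop X" and comp: "\<And>S T. S \<in> A \<Longrightarrow> T \<in> A \<Longrightarrow> S \<circ> T \<in> A"
    and S: "S \<in> opclosure X A" and T: "T \<in> opclosure X A"
  shows "S \<circ> T \<in> opclosure X A"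
  unfolding opclosure_iff[OF A]
proof (intro conjI allI impI)
  have Sb: "S \<in> bop X" and Tb: "T \<in> bop X" using S T opclosure_bop by auto
  then show "S \<circ> T \<in> bop X" by (rule bop_comp)
  fix e :: real assume e: "e > 0"
  obtain K where K: "0 \<le> K" "\<And>v. v \<in> l2 X \<Longrightarrow> l2norm X (T v) \<le> K * l2norm X v"
    using bop_bound[OF Tb] by blast
  define d where "d = e / (2 * (K + 1))"
  have d: "d > 0" "d * K \<le> e/2" using e K(1) by (auto simp: d_def field_simps)
  obtain B where B: "B \<in> A" "\<And>v. v\<in>l2 X \<Longrightarrow> l2norm X (\<lambda>y. S v y - B v y) \<le> d * l2norm X v"
    using S d(1) unfolding opclosure_iff[OF A] by meson
  have b: "B \<in> bop X" using A B by auto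
  obtain L where L: "0 \<le> L" "\<And>v. v \<in> l2 X \<Longrightarrow> l2norm X (B v) \<le> L * l2norm X v"
    using bop_bound[OF b] by blast
  \<comment> \<open>The accuracy for T is fixed only after B, because the bound L of the chosen B
    multiplies the second error term.\<close>
  define d' where "d' = e / (2 * (L + 1))"
  have d': "d' > 0" "L * d' \<le> e/2" using e L(1) by (auto simp: d'_def field_simps)
  obtain C where C: "C \<in> A" "\<And>v. v\<in>l2 X \<Longrightarrow> l2norm X (\<lambda>y. T v y - C v y) \<le> d' * l2norm X v"
    using T d'(1) unfolding opclosure_iff[OF A] by meson
  have c: "C \<in> bop X" using A C by auto
  have "l2norm X (\<lambda>y. S (T v) y - B (C v) y) \<le> e * l2norm X v" if v: "v \<in> l2 X" for v
  proof -
    have l2: "T v \<in> l2 X" "C v \<in> l2 X" using v Tb c by (auto intro: bop_l2)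
    have "l2norm X (\<lambda>y. S (T v) y - B (T v) y) \<le> d * (K * l2norm X v)"
      using B(2)[OF l2(1)] mult_left_mono[OF K(2)[OF v], of d] d(1) by linarith
    also have "\<dots> \<le> e/2 * l2norm X v"
      using mult_right_mono[OF d(2), of "l2norm X v"] by (simp add: mult.assoc)
    finally have 1: "l2norm X (\<lambda>y. S (T v) y - B (T v) y) \<le> e/2 * l2norm X v" .
    have "l2norm X (\<lambda>y. B (T v) y - B (C v) y) = l2norm X (B (\<lambda>y. T v y - C v y))"
      by (simp add: bop_diff_vec[OF b l2])
    also have "\<dots> \<le> L * (d' * l2norm X v)"
      using L(2)[OF l2_diff[OF l2]] mult_left_mono[OF C(2)[OF v] L(1)] by linarith
    also have "\<dots> \<le> e/2 * l2norm X v"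
      using mult_right_mono[OF d'(2), of "l2norm X v"] by (simp add: mult.assoc)
    finally have 2: "l2norm X (\<lambda>y. B (T v) y - B (C v) y) \<le> e/2 * l2norm X v" .
    show ?thesis
      using l2norm_triangle_diff[OF bop_l2[OF Sb l2(1)] bop_l2[OF b l2(1)] bop_l2[OF b l2(2)]] 1 2
      by (simp add: algebra_simps)
  qed
  then show "\<exists>D\<in>A. \<forall>v\<in>l2 X. l2norm X (\<lambda>y. (S \<circ> T) v y - D v y) \<le> e * l2norm X v"
    using comp[OF B(1) C(1)] by (intro bexI[where x="B \<circ> C"]) auto
qed

section \<open>Linear spans of operators\<close>

lemma lspan_zero: "(\<lambda>v y. 0) \<in> lspan A"
  unfolding lspan_def by (auto intro!: exI[of _ 0])

lemma lspan_add_scaled: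
  assumes "T \<in> lspan A" "B \<in> A"
  shows "(\<lambda>v y. T v y + c * B v y) \<in> lspan A"
proof -
  obtain k :: nat and d C where kdC: "\<forall>i<k. C i \<in> A" "T = (\<lambda>v y. \<Sum>i<k. d i * C i v y)"
    using assms(1) unfolding lspan_def by blast
  let ?d = "d(k := c)" and ?C = "C(k := B)"
  have "(\<lambda>v y. T v y + c * B v y) = (\<lambda>v y. \<Sum>i<Suc k. ?d i * ?C i v y)"
    by (simp add: kdC)
  moreover have "\<forall>i<Suc k. ?C i \<in> A"
    using kdC assms by (auto simp: less_Suc_eq)
  ultimately show ?thesis
    unfolding lspan_def by blast
qed

text \<open>Peeling off the last summand replaces index bookkeeping over coefficient sequences by
  adding one scaled generator at a time.\<close>

lemma lspan_induct [consumes 1, case_names zero step]: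
  assumes "T \<in> lspan A" "P (\<lambda>v y. 0)"
    and "\<And>T B c. T \<in> lspan A \<Longrightarrow> P T \<Longrightarrow> B \<in> A \<Longrightarrow> P (\<lambda>v y. T v y + c * B v y)"
  shows "P T"
proof -
  obtain k :: nat and d C where kdC: "\<forall>i<k. C i \<in> A" "T = (\<lambda>v y. \<Sum>i<k. d i * C i v y)"
    using assms(1) unfolding lspan_def by blast
  have "(\<lambda>v y. \<Sum>i<k. d i * C i v y) \<in> lspan A \<and> P (\<lambda>v y. \<Sum>i<k. d i * C i v y)"
    using kdC(1) by (induction k) (auto simp: lspan_zero assms lspan_add_scaled)
  then show ?thesis using kdC by simp
qed

lemma lspan_base: "B \<in> A \<Longrightarrow> B \<in> lspan A"
  using lspan_add_scaled[OF lspan_zero, of B A 1] by simp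

lemma lspan_add:
  assumes "S \<in> lspan A" "T \<in> lspan A"
  shows "(\<lambda>v y. S v y + T v y) \<in> lspan A"
  using assms(2)
proof (induction rule: lspan_induct)
  case (step T B c)
  from lspan_add_scaled[OF step.IH step.hyps(2), of c] show ?case by (simp add: add.assoc)
qed (simp add: assms)

lemma lspan_scale: "S \<in> lspan A \<Longrightarrow> (\<lambda>v y. c * S v y) \<in> lspan A"
proof (induction rule: lspan_induct)
  case (step T B d)
  from lspan_add_scaled[OF step.IH step.hyps(2), of "c * d"] show ?case by (simp add: algebra_simps)
qed (simp add: lspan_zero)

lemma lspan_sum:
  assumes "finite I" "\<And>i. i \<in> I \<Longrightarrow> T i \<in> lspan A"
  shows "(\<lambda>v y. \<Sum>i\<in>I. c i * T i v y) \<in> lspan A"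
  using assms
proof (induction I rule: finite_induct)
  case empty
  show ?case by (simp add: lspan_zero)
next
  case (insert i I)
  have "(\<lambda>v y. c i * T i v y + (\<Sum>i\<in>I. c i * T i v y)) \<in> lspan A"
    using insert by (intro lspan_add lspan_scale) auto
  then show ?case using insert(1,2) by simp
qed

lemma lspan_minimal:
  assumes "A \<subseteq> M" "(\<lambda>v y. 0) \<in> M"
    "\<And>S T. S \<in> M \<Longrightarrow> T \<in> M \<Longrightarrow> (\<lambda>v y. S v y + T v y) \<in> M"
    "\<And>S c. S \<in> M \<Longrightarrow> (\<lambda>v y. c * S v y) \<in> M"
  shows "lspan A \<subseteq> M"
proof
  fix T assume "T \<in> lspan A"
  then show "T \<in> M"
    by (induction rule: lspan_induct) (use assms in auto)
qed

lemma lspan_bop: "A \<subseteq> bop X \<Longrightarrow> lspan A \<subseteq> bop X"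
  by (intro lspan_minimal bop_zero bop_add bop_scale)

text \<open>Bilinear extension: the right factor is expanded for a fixed generator on the left, then
  the left factor. A bounded operator is linear only on \<open>l2 X\<close>, so arguments outside it
  are treated separately; there both sides vanish.\<close>

lemma lspan_comp:
  assumes A: "A \<subseteq> bop X" and AA: "\<And>B C. B \<in> A \<Longrightarrow> C \<in> A \<Longrightarrow> B \<circ> C \<in> lspan A"
    and S: "S \<in> lspan A" and T: "T \<in> lspan A"
  shows "S \<circ> T \<in> lspan A"
proof -
  have *: "B \<circ> T \<in> lspan A" if B: "B \<in> A" for B
    using T
  proof (induction rule: lspan_induct)
    case zero
    then show ?case
      using bop_zero_vec[of B X] A B by (auto simp: o_def lspan_zero)
  next
    case (step T C c)
    have bops: "B \<in> bop X" "C \<in> bop X" "T \<in> bop X"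
      using step.hyps B A lspan_bop[OF A] by blast+
    have "B (\<lambda>y. T v y + c * C v y) = (\<lambda>y. B (T v) y + c * B (C v) y)" for v
    proof (cases "v \<in> l2 X")
      case True
      show ?thesis
        using bop_lincomb[OF bops(1) bop_l2[OF bops(3) True] bop_l2[OF bops(2) True], of 1 c] by simp
    next
      case False
      then show ?thesis
        by (simp add: bop_ext[OF bops(2)] bop_ext[OF bops(3)] bop_zero_vec[OF bops(1)])
    qed
    then have "B \<circ> (\<lambda>v y. T v y + c * C v y) = (\<lambda>v y. (B \<circ> T) v y + c * (B \<circ> C) v y)"
      by (auto simp: o_def)
    then show ?case
      using lspan_add[OF step.IH lspan_scale[OF AA[OF B step.hyps(2)]], of c] by (simp only:)
  qed
  show ?thesis
    using S
  proof (induction rule: lspan_induct)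
    case (step S B c)
    have "(\<lambda>v y. S v y + c * B v y) \<circ> T = (\<lambda>v y. (S \<circ> T) v y + c * (B \<circ> T) v y)"
      by (auto simp: o_def)
    then show ?case
      using lspan_add[OF step.IH lspan_scale[OF *[OF step.hyps(2)]], of c] by (simp only:)
  qed (simp add: o_def lspan_zero)
qed

lemma lspan_adj:
  assumes A: "A \<subseteq> bop X" and adj: "\<And>B. B \<in> A \<Longrightarrow> adj X B \<in> lspan A" and S: "S \<in> lspan A"
  shows "adj X S \<in> lspan A"
  using S
proof (induction rule: lspan_induct)
  case zero
  have "adj X (\<lambda>v y. 0) = (\<lambda>v y. 0)"
    using adj_lincomb[OF bop_idop bop_idop, of X 0 0] by simp
  then show ?case by (simp add: lspan_zero)
next
  case (step S B c)
  have "S \<in> bop X" "B \<in> bop X" using step.hyps A lspan_bop[OF A] by blast+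
  from adj_lincomb[OF this, of 1 c]
  have "adj X (\<lambda>v y. S v y + c * B v y) = (\<lambda>v y. adj X S v y + cnj c * adj X B v y)"
    by simp
  then show ?case
    by (rule ssubst) (rule lspan_add[OF step.IH lspan_scale[OF adj[OF step.hyps(2)]]])
qed

lemma opclosure_lspan_subset:
  assumes A: "A \<subseteq> bop Y" and B: "B \<subseteq> opclosure Y (lspan A)"
  shows "lspan B \<subseteq> opclosure Y (lspan A)"
proof (rule lspan_minimal[OF B])
  note lb = lspan_bop[OF A]
  show "(\<lambda>v y. 0) \<in> opclosure Y (lspan A)"
    using opclosure_superset[OF lb] lspan_zero by blast
  show "(\<lambda>v y. S v y + T v y) \<in> opclosure Y (lspan A)"
    if "S \<in> opclosure Y (lspan A)" "T \<in> opclosure Y (lspan A)" for S T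
    by (rule opclosure_add[OF lb lspan_add that])
  show "(\<lambda>v y. c * S v y) \<in> opclosure Y (lspan A)" if "S \<in> opclosure Y (lspan A)" for S c
    by (rule opclosure_scale[OF lb lspan_scale that])
qed

text \<open>The closed span is itself one of the algebras in the intersection defining
  \<open>cstar_gen\<close>: algebraic closure of the span passes to its norm closure.\<close>

lemma cstar_gen_subset_opclosure_lspan:
  assumes A: "A \<subseteq> bop X" and G: "G \<subseteq> lspan A"
    and comp: "\<And>B C. B \<in> A \<Longrightarrow> C \<in> A \<Longrightarrow> B \<circ> C \<in> lspan A"
    and adj: "\<And>B. B \<in> A \<Longrightarrow> adj X B \<in> lspan A"
  shows "cstar_gen X G \<subseteq> opclosure X (lspan A)"
  unfolding cstar_gen_def
proof (rule Inter_lower, rule CollectI, intro conjI ballI allI)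
  note lb = lspan_bop[OF A]
  show "G \<subseteq> opclosure X (lspan A)"
    using G opclosure_superset[OF lb] by (rule subset_trans)
  show "opclosure X (lspan A) \<subseteq> bop X"
    by (rule opclosure_bop)
  show "opclosure X (opclosure X (lspan A)) \<subseteq> opclosure X (lspan A)"
    by (rule opclosure_idem[OF lb])
  fix S assume S: "S \<in> opclosure X (lspan A)"
  show "(\<lambda>v y. c * S v y) \<in> opclosure X (lspan A)" for c
    by (rule opclosure_scale[OF lb lspan_scale S])
  show "adj X S \<in> opclosure X (lspan A)"
    by (rule opclosure_adj[OF lb lspan_adj[OF A adj] S])
  fix T assume T: "T \<in> opclosure X (lspan A)"
  show "(\<lambda>v y. S v y + T v y) \<in> opclosure X (lspan A)"
    by (rule opclosure_add[OF lb lspan_add S T])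
  show "S \<circ> T \<in> opclosure X (lspan A)"
    by (rule opclosure_comp[OF lb lspan_comp[OF A comp] S T])
qed

section \<open>Operators induced by partial injections\<close>

text \<open>Composition is contravariant: for z in D and injective h, \<open>delta (h z)\<close>
  goes to \<open>delta z\<close>, so basis vectors move along the inverse of h. Composing two such
  operators composes the maps in the opposite order.\<close>

definition pullback :: "real set \<Rightarrow> real set \<Rightarrow> (real \<Rightarrow> real) \<Rightarrow> oper" where
  "pullback X D h = (\<lambda>v. if v \<in> l2 X then (\<lambda>z. if z \<in> D then v (h z) else 0) else (\<lambda>_. 0))"

lemma pullback_cong: "D = D' \<Longrightarrow> (\<And>z. z \<in> D' \<Longrightarrow> h z = h' z) \<Longrightarrow> pullback X D h = pullback X D' h'"
  by (auto simp: pullback_def fun_eq_iff)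

text \<open>Kept as an equality over finite sets, not merely a norm inequality, because the matrix
  estimate adds such sums over disjoint images.\<close>

lemma sum_norm2_pullback:
  assumes "v \<in> l2 X" "inj_on h D" "finite F"
  shows "(\<Sum>z\<in>F. (cmod (pullback X D h v z))\<^sup>2) = (\<Sum>y\<in>h ` (F \<inter> D). (cmod (v y))\<^sup>2)"
proof -
  have "(\<Sum>z\<in>F. (cmod (pullback X D h v z))\<^sup>2) = (\<Sum>z\<in>F \<inter> D. (cmod (v (h z)))\<^sup>2)"
    using assms by (subst sum.inter_restrict) (auto simp: pullback_def intro!: sum.cong)
  also have "\<dots> = (\<Sum>y\<in>h ` (F \<inter> D). (cmod (v y))\<^sup>2)"
    using assms(2) by (subst sum.reindex) (auto intro: inj_on_subset)
  finally show ?thesis .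
qed

lemma pullback_bop:
  assumes "D \<subseteq> X" "inj_on h D" "h ` D \<subseteq> X"
  shows "pullback X D h \<in> bop X"
proof -
  have *: "L2_set (\<lambda>z. cmod (pullback X D h v z)) F \<le> l2norm X v" if "v \<in> l2 X" "finite F" for v F
  proof -
    have "(\<Sum>z\<in>F. (cmod (pullback X D h v z))\<^sup>2) \<le> (l2norm X v)\<^sup>2"
      unfolding sum_norm2_pullback[OF that(1) assms(2) that(2)]
      using that assms by (intro sum_norm2_le_l2norm2) auto
    then show ?thesis
      by (simp add: L2_set_def real_le_lsqrt sum_nonneg)
  qed
  have **: "pullback X D h v \<in> l2 X" "l2norm X (pullback X D h v) \<le> 1 * l2norm X v" if "v \<in> l2 X" for v
  proof -
    have "pullback X D h v y = 0" if "y \<notin> X" for y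
      using that assms(1) by (auto simp: pullback_def)
    from l2_boundI[OF this *[OF \<open>v \<in> l2 X\<close>]]
    show "pullback X D h v \<in> l2 X" "l2norm X (pullback X D h v) \<le> 1 * l2norm X v"
      by simp_all
  qed
  show ?thesis
  proof (rule bopI[where K=1])
    show "pullback X D h (\<lambda>y. c * v y + a * w y) = (\<lambda>y. c * pullback X D h v y + a * pullback X D h w y)"
      if "v \<in> l2 X" "w \<in> l2 X" for v w c a
      using that l2_lincomb[OF that] by (auto simp: pullback_def)
    show "pullback X D h v = (\<lambda>_. 0)" if "v \<notin> l2 X" for v
      using that by (simp add: pullback_def)
  qed (rule **; assumption)+
qed

lemma pullback_comp:
  assumes "pullback X D' h' \<in> bop X"
  shows "pullback X D h \<circ> pullback X D' h' = pullback X {z \<in> D. h z \<in> D'} (h' \<circ> h)"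
proof
  fix v
  show "(pullback X D h \<circ> pullback X D' h') v = pullback X {z \<in> D. h z \<in> D'} (h' \<circ> h) v"
    using bop_l2[OF assms, of v] by (auto simp: pullback_def)
qed

text \<open>Reindexing the inner product along the bijection h from D to D' moves the substitution
  onto the other vector as the inverse k.\<close>

lemma adj_pullback:
  assumes "D \<subseteq> X" "D' \<subseteq> X" "h ` D \<subseteq> D'" "k ` D' \<subseteq> D"
    and kh: "\<And>z. z \<in> D \<Longrightarrow> k (h z) = z" and hk: "\<And>y. y \<in> D' \<Longrightarrow> h (k y) = y"
  shows "adj X (pullback X D h) = pullback X D' k"
proof (rule adj_eqI)
  have inj: "inj_on h D" "inj_on k D'"
    using kh hk by (metis inj_on_def)+
  have bij: "bij_betw h D D'"
    using assms by (intro bij_betw_byWitness[where f'=k]) auto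
  have "l2inner X (pullback X D h v) w = l2inner X v (pullback X D' k w)" if "v \<in> l2 X" "w \<in> l2 X" for v w
  proof -
    have "l2inner X (pullback X D h v) w = infsum (\<lambda>z. v (h z) * cnj (w z)) D"
      unfolding l2inner_def using assms that by (intro infsum_cong_neutral) (auto simp: pullback_def)
    also have "\<dots> = infsum (\<lambda>z. (\<lambda>y. v y * cnj (w (k y))) (h z)) D"
      by (intro infsum_cong) (simp add: kh)
    also have "\<dots> = infsum (\<lambda>y. v y * cnj (w (k y))) D'"
      by (rule infsum_reindex_bij_betw[OF bij])
    also have "\<dots> = l2inner X v (pullback X D' k w)"
      unfolding l2inner_def using assms that by (intro infsum_cong_neutral) (auto simp: pullback_def)
    finally show ?thesis .
  qed
  moreover have "pullback X D' k \<in> bop X"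
    using assms inj by (intro pullback_bop) auto
  ultimately show "is_adj X (pullback X D h) (pullback X D' k)"
    by (simp add: is_adj_def)
qed

section \<open>Words and the Cuntz isometries\<close>

text \<open>For a word u, \<open>ctr n u\<close> maps [0,1[ affinely onto the cylinder
  \<open>phi n u\<close>, and \<open>dil n u\<close> inverts it; on the cylinder,
  \<open>dil n u\<close> is the iterate of \<open>fmap n\<close> of order
  \<open>length u\<close>.\<close>

abbreviation dil :: "nat \<Rightarrow> nat list \<Rightarrow> real \<Rightarrow> real" where
  "dil n u z \<equiv> (z - phil n u) * real n ^ length u"

abbreviation ctr :: "nat \<Rightarrow> nat list \<Rightarrow> real \<Rightarrow> real" where
  "ctr n u y \<equiv> phil n u + y / real n ^ length u"

lemma phil_Nil [simp]: "phil n [] = 0"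
  by (simp add: phil_def)

lemma phil_Cons: "phil n (i # u) = (real i - 1) / real n + phil n u / real n"
  by (simp add: phil_def sum.lessThan_Suc_shift sum_divide_distrib mult_ac del: sum.lessThan_Suc)

lemma phi_Nil [simp]: "phi n [] = {0..<1}"
  by (simp add: phi_def)

lemma is_prefix_Nil [simp]: "is_prefix [] w"
  by (simp add: is_prefix_def)

lemma is_prefix_Cons: "is_prefix (i # u) w \<longleftrightarrow> w 0 = i \<and> is_prefix u (\<lambda>k. w (Suc k))"
  by (auto simp: is_prefix_def nth_Cons less_Suc_eq_0_disj split: nat.splits)

lemma word_Cons: "word n (i # u) \<longleftrightarrow> i \<in> {1..n} \<and> word n u"
  by (auto simp: word_def)

lemma word_Nil [simp]: "word n []"
  by (simp add: word_def)

lemma word_append: "word n (u @ v) \<longleftrightarrow> word n u \<and> word n v"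
  by (auto simp: word_def)

lemma admissible_finite: "admissible n L \<Longrightarrow> finite L"
  and admissible_word: "admissible n L \<Longrightarrow> u \<in> L \<Longrightarrow> word n u"
  unfolding admissible_def by blast+

lemma admissible_ex1:
  "admissible n L \<Longrightarrow> \<forall>k. w k \<in> {1..n} \<Longrightarrow> \<exists>!u. u \<in> L \<and> is_prefix u w"
  unfolding admissible_def by (elim conjE allE[of _ w] impE)

section \<open>Cylinders, the orbit and the isometries\<close>

locale cuntz =
  fixes n :: nat and x :: real
  assumes n2: "n \<ge> 2"
begin

abbreviation X where "X \<equiv> orb n x"

lemma n_pos: "0 < real n"
  using n2 by simp

lemma dil_ctr: "dil n u (ctr n u y) = y" and ctr_dil: "ctr n u (dil n u y) = y"
  using n_pos by auto

lemma mem_phi_iff: "z \<in> phi n u \<longleftrightarrow> dil n u z \<in> {0..<1}"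
  using n_pos by (auto simp: phi_def field_simps)

lemma ctr_mem_phi: "y \<in> {0..<1} \<Longrightarrow> ctr n u y \<in> phi n u"
  by (simp only: mem_phi_iff dil_ctr)

lemma dil_Cons: "dil n (i # u) z = dil n u (real n * z - (real i - 1))"
  using n_pos by (simp add: phil_Cons field_simps)

lemma mem_phi_Cons: "z \<in> phi n (i # u) \<longleftrightarrow> real n * z - (real i - 1) \<in> phi n u"
  by (simp only: mem_phi_iff dil_Cons)

lemma phi_subset: "word n u \<Longrightarrow> phi n u \<subseteq> {0..<1}"
proof (induction u)
  case (Cons i u)
  show ?case
  proof
    fix z assume "z \<in> phi n (i # u)"
    then have "real n * z - (real i - 1) \<in> {0..<1}"
      using Cons by (auto simp: mem_phi_Cons word_Cons)
    moreover have "1 \<le> real i" "real i \<le> real n"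
      using Cons by (auto simp: word_Cons)
    ultimately have "0 \<le> real n * z" "real n * z < real n * 1"
      unfolding atLeastLessThan_iff by linarith+
    then show "z \<in> {0..<1}"
      using n_pos unfolding mult_less_cancel_left_pos[OF n_pos] by (auto simp: zero_le_mult_iff)
  qed
qed simp

lemma fmap_eq:
  assumes "real n * z - (real i - 1) \<in> {0..<1}"
  shows "fmap n z = real n * z - (real i - 1)"
proof -
  have "real i - 1 \<in> \<int>" by simp
  with assms show ?thesis
    unfolding fmap_def by (subst frac_unique_iff) auto
qed

lemma orb_subset: "y \<in> X \<Longrightarrow> y \<in> {0..<1}"
  by (simp add: orb_def)

lemma fmap_orb: "y \<in> X \<Longrightarrow> fmap n y \<in> X"
proof -
  assume "y \<in> X"
  then obtain p q where "(fmap n ^^ p) y = (fmap n ^^ q) x"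
    by (auto simp: orb_def)
  then have "fmap n ((fmap n ^^ p) y) = (fmap n ^^ Suc q) x"
    by simp
  then have "(fmap n ^^ p) (fmap n y) = (fmap n ^^ Suc q) x"
    by (simp only: funpow_swap1)
  moreover have "fmap n y \<in> {0..<1}"
    by (simp add: fmap_def frac_lt_1)
  ultimately show "fmap n y \<in> X"
    unfolding orb_def by blast
qed

lemma orb_of_fmap:
  assumes "y \<in> {0..<1}" "fmap n y \<in> X" shows "y \<in> X"
proof -
  obtain p q where "(fmap n ^^ p) (fmap n y) = (fmap n ^^ q) x"
    using assms by (auto simp: orb_def)
  then have "(fmap n ^^ Suc p) y = (fmap n ^^ q) x"
    by (simp only: funpow_Suc_right o_apply)
  with assms(1) show ?thesis
    unfolding orb_def by blast
qed

text \<open>Each letter removed is one application of \<open>fmap n\<close>, under which the orbit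
  is forward invariant.\<close>

lemma dil_orb: "word n u \<Longrightarrow> z \<in> X \<inter> phi n u \<Longrightarrow> dil n u z \<in> X"
proof (induction u arbitrary: z)
  case (Cons i u)
  have *: "real n * z - (real i - 1) \<in> phi n u"
    using Cons by (auto simp: mem_phi_Cons)
  have "fmap n z = real n * z - (real i - 1)"
    using * phi_subset[of u] Cons.prems(1) by (intro fmap_eq) (auto simp: word_Cons)
  moreover have "fmap n z \<in> X"
    using Cons by (auto intro: fmap_orb)
  ultimately show ?case
    using Cons * by (simp only: dil_Cons) (auto simp: word_Cons)
qed simp

text \<open>Each letter added selects a preimage under \<open>fmap n\<close>, and the orbit contains
  all its preimages in [0,1[. Together with \<open>dil_orb\<close> this makes \<open>dil n u\<close>
  a bijection from the part of the orbit in the cylinder onto the whole orbit.\<close>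

lemma ctr_orb: "word n u \<Longrightarrow> y \<in> X \<Longrightarrow> ctr n u y \<in> X \<inter> phi n u"
proof (induction u)
  case Nil
  then show ?case using orb_subset by simp
next
  case (Cons i u)
  let ?z = "ctr n (i # u) y"
  have phi: "?z \<in> phi n (i # u)"
    using orb_subset[OF Cons.prems(2)] by (rule ctr_mem_phi)
  then have z1: "?z \<in> {0..<1}"
    using phi_subset Cons.prems(1) by blast
  have eq: "real n * ?z - (real i - 1) = ctr n u y"
    using n_pos by (simp add: phil_Cons field_simps)
  have IH: "ctr n u y \<in> X \<inter> phi n u"
    using Cons by (auto simp: word_Cons)
  have "fmap n ?z = real n * ?z - (real i - 1)"
    using IH orb_subset unfolding eq[symmetric] by (intro fmap_eq) blast
  then have "fmap n ?z \<in> X"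
    using IH by (simp only: eq Int_iff)
  with z1 have "?z \<in> X"
    by (rule orb_of_fmap)
  with phi show ?case by blast
qed

lemma dil_pullback_bop: "word n u \<Longrightarrow> pullback X (X \<inter> phi n u) (dil n u) \<in> bop X"
  using dil_orb n_pos by (intro pullback_bop) (auto simp: inj_on_def)

lemma Sop_eq_pullback: "Sop n x i = pullback X (X \<inter> phi n [i]) (dil n [i])"
proof -
  have *: "z \<in> phi n [i] \<longleftrightarrow> (real i - 1) / real n \<le> z \<and> z < real i / real n" for z
    using n_pos by (simp add: phi_def phil_Cons field_simps)
  have **: "dil n [i] z = real n * z - (real i - 1)" for z
    by (simp only: dil_Cons) simp
  show ?thesis
    unfolding Sop_def pullback_def Int_iff * ** by (auto simp: fun_eq_iff)
qed

lemma Sop_bop: "i \<in> {1..n} \<Longrightarrow> Sop n x i \<in> bop X"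
  unfolding Sop_eq_pullback by (intro dil_pullback_bop) (simp add: word_Cons)

lemma Sword_Nil: "Sword n x [] = idop X"
  by (simp add: Sword_def)

lemma Sword_Cons: "Sword n x (i # u) = Sop n x i \<circ> Sword n x u"
  by (simp add: Sword_def)

lemma Sword_eq_pullback: "word n u \<Longrightarrow> Sword n x u = pullback X (X \<inter> phi n u) (dil n u)"
proof (induction u)
  case Nil
  show ?case
    unfolding Sword_Nil
  proof
    fix v
    show "idop X v = pullback X (X \<inter> phi n []) (dil n []) v"
      using orb_subset by (cases "v \<in> l2 X") (auto simp: idop_def pullback_def fun_eq_iff intro: l2_zero_off)
  qed
next
  case (Cons i u)
  then have w: "word n [i]" "word n u" by (auto simp: word_Cons)
  have d: "dil n [i] z = real n * z - (real i - 1)" for z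
    by (simp only: dil_Cons) simp
  have "Sword n x (i # u) = pullback X (X \<inter> phi n [i]) (dil n [i]) \<circ> pullback X (X \<inter> phi n u) (dil n u)"
    using Cons w by (simp add: Sword_Cons Sop_eq_pullback)
  also have "\<dots> = pullback X {z \<in> X \<inter> phi n [i]. dil n [i] z \<in> X \<inter> phi n u} (dil n u \<circ> dil n [i])"
    by (intro pullback_comp dil_pullback_bop w)
  \<comment> \<open>The domain simplifies because the cylinder of \<open>i # u\<close> lies in that
    of \<open>[i]\<close>, and dilation by \<open>[i]\<close> stays in the orbit.\<close>
  also have "\<dots> = pullback X (X \<inter> phi n (i # u)) (dil n (i # u))"
  proof (rule pullback_cong)
    have "z \<in> phi n [i]" if "z \<in> phi n (i # u)" for z
      using that phi_subset[OF w(2)] by (auto simp: mem_phi_Cons)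
    moreover have "dil n [i] z \<in> phi n u \<longleftrightarrow> z \<in> phi n (i # u)" for z
      by (simp only: d mem_phi_Cons)
    moreover have "dil n [i] z \<in> X" if "z \<in> X \<inter> phi n [i]" for z
      using dil_orb[OF w(1) that] .
    ultimately show "{z \<in> X \<inter> phi n [i]. dil n [i] z \<in> X \<inter> phi n u} = X \<inter> phi n (i # u)"
      by blast
    show "(dil n u \<circ> dil n [i]) z = dil n (i # u) z" for z
      by (simp only: o_apply d dil_Cons[where i=i and u=u])
  qed
  finally show ?case .
qed

lemma Sword_bop: "word n u \<Longrightarrow> Sword n x u \<in> bop X"
  by (simp add: Sword_eq_pullback dil_pullback_bop)

lemma adj_Sword_eq_pullback: "word n u \<Longrightarrow> adj X (Sword n x u) = pullback X X (ctr n u)"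
  unfolding Sword_eq_pullback
proof (rule adj_pullback)
  assume u: "word n u"
  show "dil n u ` (X \<inter> phi n u) \<subseteq> X" using dil_orb[OF u] by blast
  show "ctr n u ` X \<subseteq> X \<inter> phi n u" using ctr_orb[OF u] by blast
qed (simp_all only: dil_ctr ctr_dil Int_lower1 order_refl)

text \<open>A matrix unit between cylinders: for y in the orbit, \<open>delta (ctr n v y)\<close>
  goes to \<open>delta (ctr n u y)\<close>, and basis vectors outside the cylinder of v are
  annihilated.\<close>

definition Eop :: "nat list \<Rightarrow> nat list \<Rightarrow> oper" where
  "Eop u v = Sword n x u \<circ> adj X (Sword n x v)"

lemma Eop_bop: "word n u \<Longrightarrow> word n v \<Longrightarrow> Eop u v \<in> bop X"
  unfolding Eop_def by (intro bop_comp adj_bop Sword_bop)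

lemma Eop_eq_pullback:
  assumes "word n u" "word n v"
  shows "Eop u v = pullback X (X \<inter> phi n u) (\<lambda>z. ctr n v (dil n u z))"
proof -
  have "pullback X X (ctr n v) \<in> bop X"
    using adj_bop[OF Sword_bop[OF assms(2)]] by (simp add: adj_Sword_eq_pullback assms)
  then have "Eop u v = pullback X {z \<in> X \<inter> phi n u. dil n u z \<in> X} (ctr n v \<circ> dil n u)"
    unfolding Eop_def adj_Sword_eq_pullback[OF assms(2)] Sword_eq_pullback[OF assms(1)] by (rule pullback_comp)
  also have "\<dots> = pullback X (X \<inter> phi n u) (\<lambda>z. ctr n v (dil n u z))"
    using dil_orb[OF assms(1)] by (intro pullback_cong) auto
  finally show ?thesis .
qed

lemma Eop_ctr_dil:
  assumes "word n u" "word n v" "z \<in> X \<inter> phi n u"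
  shows "ctr n v (dil n u z) \<in> X \<inter> phi n v"
  using assms by (intro ctr_orb dil_orb)

section \<open>Base-n digits and tilings by cylinders\<close>

text \<open>The base-n expansion of y produced by \<open>fmap n\<close>, with digits shifted by 1
  into the alphabet {1..n}.\<close>

definition dig :: "real \<Rightarrow> nat \<Rightarrow> nat" where
  "dig y k = nat \<lfloor>real n * (fmap n ^^ k) y\<rfloor> + 1"

lemma dig_Suc: "dig y (Suc k) = dig (fmap n y) k"
  by (simp add: dig_def funpow_swap1)

lemma funpow_fmap_mem: "y \<in> {0..<1} \<Longrightarrow> (fmap n ^^ k) y \<in> {0..<1}"
  by (cases k) (auto simp: fmap_def frac_lt_1)

lemma dig_mem: "y \<in> {0..<1} \<Longrightarrow> dig y k \<in> {1..n}"
proof -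
  assume "y \<in> {0..<1}"
  from funpow_fmap_mem[OF this, of k]
  have "0 \<le> real n * (fmap n ^^ k) y" "real n * (fmap n ^^ k) y < real n"
    using n_pos by auto
  then have "0 \<le> \<lfloor>real n * (fmap n ^^ k) y\<rfloor>" "\<lfloor>real n * (fmap n ^^ k) y\<rfloor> < int n"
    by (auto simp: floor_less_iff)
  then show ?thesis
    unfolding dig_def atLeastAtMost_iff by linarith
qed

text \<open>Half-open cylinders agree with the expansion chosen by the floor function, so no
  endpoint is ambiguous. The induction strips the first letter and applies \<open>fmap n\<close>
  once.\<close>

lemma mem_phi_iff_prefix: "word n u \<Longrightarrow> y \<in> {0..<1} \<Longrightarrow> y \<in> phi n u \<longleftrightarrow> is_prefix u (dig y)"
proof (induction u arbitrary: y)
  case (Cons i u)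
  have w: "word n u" "1 \<le> i" using Cons by (auto simp: word_Cons)
  have 0: "dig y 0 = i \<longleftrightarrow> real n * y - (real i - 1) \<in> {0..<1}"
  proof -
    have "dig y 0 = i \<longleftrightarrow> nat \<lfloor>real n * y\<rfloor> + 1 = i" by (simp add: dig_def)
    also have "\<dots> \<longleftrightarrow> \<lfloor>real n * y\<rfloor> = int i - 1"
      using w Cons.prems(2) n_pos by auto
    also have "\<dots> \<longleftrightarrow> real n * y - (real i - 1) \<in> {0..<1}"
      by (auto simp: floor_eq_iff)
    finally show ?thesis .
  qed
  have f: "fmap n y \<in> {0..<1}" by (simp add: fmap_def frac_lt_1)
  have "y \<in> phi n (i # u) \<longleftrightarrow> dig y 0 = i \<and> fmap n y \<in> phi n u"
  proof (cases "dig y 0 = i")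
    case True
    with 0 fmap_eq[of y i] show ?thesis by (simp add: mem_phi_Cons)
  next
    case False
    with 0 phi_subset[OF w(1)] show ?thesis by (auto simp: mem_phi_Cons)
  qed
  also have "\<dots> \<longleftrightarrow> is_prefix (i # u) (dig y)"
    using Cons.IH[OF w(1) f] by (simp add: is_prefix_Cons dig_Suc)
  finally show ?case .
qed simp

text \<open>Lists rather than sets, because the group elements match source and target words by
  index.\<close>

definition partition_words :: "nat list list \<Rightarrow> bool" where
  "partition_words b \<longleftrightarrow> distinct b \<and> admissible n (set b)"

lemma partition_word: "partition_words b \<Longrightarrow> i < length b \<Longrightarrow> word n (b ! i)"
  unfolding partition_words_def using admissible_word nth_mem by blast

text \<open>Admissibility speaks of infinite words; applied to \<open>dig y\<close> it selects
  exactly one cylinder containing y. Distinctness turns the unique word into a unique index.\<close>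

lemma partition_ex1:
  assumes "partition_words b" "y \<in> {0..<1}"
  shows "\<exists>!i. i < length b \<and> y \<in> phi n (b ! i)"
proof -
  have adm: "admissible n (set b)" and d: "distinct b"
    using assms by (auto simp: partition_words_def)
  have "\<forall>k. dig y k \<in> {1..n}" using dig_mem[OF assms(2)] by blast
  then have ex1: "\<exists>!u. u \<in> set b \<and> is_prefix u (dig y)"
    by (rule admissible_ex1[OF adm])
  have eq: "y \<in> phi n u \<longleftrightarrow> is_prefix u (dig y)" if "u \<in> set b" for u
    using adm that assms(2) by (intro mem_phi_iff_prefix) (auto intro: admissible_word)
  obtain u where u: "u \<in> set b" "is_prefix u (dig y)" using ex1 by blast
  then obtain i where i: "i < length b" "b ! i = u" by (auto simp: in_set_conv_nth)
  show ?thesis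
  proof (rule ex1I[of _ i])
    show "i < length b \<and> y \<in> phi n (b ! i)" using i u eq by auto
    fix j assume j: "j < length b \<and> y \<in> phi n (b ! j)"
    then have "b ! j = u" using eq[of "b ! j"] u ex1 by auto
    then show "j = i" using i j d by (auto simp: nth_eq_iff_index_eq)
  qed
qed

lemma partition_disjoint:
  assumes "partition_words b" "i < length b" "j < length b" "y \<in> phi n (b ! i)" "y \<in> phi n (b ! j)"
  shows "i = j"
proof -
  have "y \<in> {0..<1}"
    using phi_subset[OF partition_word[OF assms(1,2)]] assms(4) by blast
  from partition_ex1[OF assms(1) this] assms show ?thesis by blast
qed

section \<open>Elements of the group and their operators\<close>

text \<open>Values off [0,1[ are unspecified, which is harmless because membership in
  \<open>Vn\<close> constrains a function only on that interval.\<close>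

definition rearrange :: "nat list list \<Rightarrow> nat list list \<Rightarrow> real \<Rightarrow> real" where
  "rearrange a b y = (let i = (THE i. i < length b \<and> y \<in> phi n (b ! i)) in ctr n (a ! i) (dil n (b ! i) y))"

lemma rearrange_eq:
  assumes "partition_words b" "i < length b" "y \<in> phi n (b ! i)"
  shows "rearrange a b y = ctr n (a ! i) (dil n (b ! i) y)"
proof -
  have "(THE i. i < length b \<and> y \<in> phi n (b ! i)) = i"
    using assms partition_disjoint[OF assms(1)] by (intro the_equality) auto
  then show ?thesis by (simp add: rearrange_def Let_def)
qed

lemma rearrange_inverse:
  assumes "partition_words a" "partition_words b" "length a = length b" "y \<in> {0..<1}"
  shows "rearrange a b y \<in> {0..<1}" "rearrange b a (rearrange a b y) = y"
proof -
  obtain i where i: "i < length b" "y \<in> phi n (b ! i)"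
    using partition_ex1[OF assms(2,4)] by blast
  then have mem: "rearrange a b y \<in> phi n (a ! i)"
    unfolding rearrange_eq[OF assms(2) i] by (intro ctr_mem_phi) (simp add: mem_phi_iff)
  then show "rearrange a b y \<in> {0..<1}"
    using phi_subset[OF partition_word[OF assms(1), of i]] i assms(3) by auto
  have "rearrange b a (rearrange a b y) = ctr n (b ! i) (dil n (a ! i) (rearrange a b y))"
    using i assms mem by (intro rearrange_eq) auto
  also have "\<dots> = y"
    by (simp only: rearrange_eq[OF assms(2) i] dil_ctr ctr_dil)
  finally show "rearrange b a (rearrange a b y) = y" .
qed

lemma rearrange_Vn:
  assumes "partition_words a" "partition_words b" "length a = length b"
  shows "rearrange a b \<in> Vn n" "V_witness n (rearrange a b) a b"
proof -
  show w: "V_witness n (rearrange a b) a b"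
    using assms rearrange_eq[OF assms(2), of _ _ a] unfolding V_witness_def partition_words_def by simp
  have "bij_betw (rearrange a b) {0..<1} {0..<1}"
    using assms rearrange_inverse[of a b] rearrange_inverse[of b a]
    by (intro bij_betw_byWitness[where f'="rearrange b a"]) auto
  with w show "rearrange a b \<in> Vn n"
    unfolding Vn_def by blast
qed

text \<open>At z only the summand whose target cylinder contains z survives, and its source point is
  the preimage of z under g. The right-hand side no longer mentions the witness.\<close>

lemma sum_Eop_witness:
  assumes w: "V_witness n g a b" and bij: "bij_betw g {0..<1} {0..<1}" and v: "v \<in> l2 X"
  shows "(\<Sum>i<length a. Eop (a ! i) (b ! i) v z) = (if z \<in> X then v (inv_into {0..<1} g z) else 0)"
proof (cases "z \<in> X")
  case True
  have pa: "partition_words a" and pb: "partition_words b" and len: "length a = length b"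
    using w by (auto simp: V_witness_def partition_words_def)
  obtain i where i: "i < length a" "z \<in> phi n (a ! i)"
    using partition_ex1[OF pa orb_subset[OF True]] by blast
  have words: "word n (a ! j)" "word n (b ! j)" if "j < length a" for j
    using that partition_word[OF pa] partition_word[OF pb] len by auto
  have E: "Eop (a ! j) (b ! j) v z = (if j = i then v (ctr n (b ! i) (dil n (a ! i) z)) else 0)"
    if "j < length a" for j
  proof (cases "j = i")
    case True
    then show ?thesis
      using \<open>z \<in> X\<close> v i(2) by (simp add: Eop_eq_pullback[OF words[OF i(1)]] pullback_def)
  next
    case False
    then have "z \<notin> phi n (a ! j)"
      using partition_disjoint[OF pa i(1) that i(2)] by blast
    then show ?thesis
      using False by (simp add: Eop_eq_pullback[OF words[OF that]] pullback_def)
  qed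
  let ?t = "ctr n (b ! i) (dil n (a ! i) z)"
  have t: "?t \<in> phi n (b ! i)"
    using Eop_ctr_dil[OF words[OF i(1)]] True i by blast
  then have "?t \<in> {0..<1}" using phi_subset[OF words(2)[OF i(1)]] by blast
  moreover have "g ?t = z"
  proof -
    have "g ?t = ctr n (a ! i) (dil n (b ! i) ?t)"
      using w i t unfolding V_witness_def by blast
    then show ?thesis by (simp only: dil_ctr ctr_dil)
  qed
  ultimately have "inv_into {0..<1} g z = ?t"
    using bij by (intro inv_into_f_eq) (auto simp: bij_betw_def)
  then show ?thesis
    using E True i(1) by simp
next
  case False
  have "word n (a ! j)" "word n (b ! j)" if "j < length a" for j
    using that w by (auto simp: V_witness_def intro: admissible_word)
  with False show ?thesis
    by (auto simp: Eop_eq_pullback pullback_def intro!: sum.neutral)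
qed

text \<open>This is where the choice of a witness in the definition of rho is seen to be irrelevant.\<close>
lemma rho_eq:
  assumes w: "V_witness n g a b" and bij: "bij_betw g {0..<1} {0..<1}"
  shows "rho n x g = (\<lambda>v y. \<Sum>i<length a. Eop (a ! i) (b ! i) v y)"
proof -
  obtain a' b' where some: "(SOME (a, b). V_witness n g a b) = (a', b')"
    by fastforce
  have w': "V_witness n g a' b'"
    using someI[of "\<lambda>(a, b). V_witness n g a b" "(a, b)"] w some by simp
  have zero: "(\<Sum>i<length c. Eop (c ! i) (d ! i) v y) = 0" if "v \<notin> l2 X" "V_witness n g c d" for v y c d
  proof -
    have "word n (c ! j)" "word n (d ! j)" if "j < length c" for j
      using that \<open>V_witness n g c d\<close> by (auto simp: V_witness_def intro: admissible_word)
    then show ?thesis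
      using that(1) by (auto simp: Eop_eq_pullback pullback_def intro!: sum.neutral)
  qed
  have "rho n x g = (\<lambda>v y. \<Sum>i<length a'. Eop (a' ! i) (b' ! i) v y)"
    by (simp add: rho_def some Eop_def)
  also have "\<dots> = (\<lambda>v y. \<Sum>i<length a. Eop (a ! i) (b ! i) v y)"
  proof (intro ext)
    fix v y
    show "(\<Sum>i<length a'. Eop (a' ! i) (b' ! i) v y) = (\<Sum>i<length a. Eop (a ! i) (b ! i) v y)"
      using sum_Eop_witness[OF w bij, of v y] sum_Eop_witness[OF w' bij, of v y] zero[OF _ w] zero[OF _ w']
      by (cases "v \<in> l2 X") auto
  qed
  finally show ?thesis .
qed

lemma rho_rearrange:
  assumes "partition_words a" "partition_words b" "length a = length b"
  shows "rho n x (rearrange a b) = (\<lambda>v y. \<Sum>i<length a. Eop (a ! i) (b ! i) v y)"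
  using rearrange_Vn[OF assms] by (intro rho_eq) (auto simp: Vn_def)

section \<open>Sizes of admissible languages\<close>

lemma admissible_Nil: "admissible n {[]}"
  by (auto simp: admissible_def)

text \<open>Viewing a language as the leaves of a finite n-ary tree, this hangs n trees below a
  common root; the leaf counts add up.\<close>

lemma admissible_glue:
  assumes "\<And>i. i \<in> {1..n} \<Longrightarrow> admissible n (L i)"
  shows "admissible n (\<Union>i\<in>{1..n}. (#) i ` L i)" (is "admissible n ?L")
    and "card (\<Union>i\<in>{1..n}. (#) i ` L i) = (\<Sum>i\<in>{1..n}. card (L i))"
proof -
  note fin = admissible_finite[OF assms] and words = admissible_word[OF assms]
  have ex1: "\<exists>!u. u \<in> ?L \<and> is_prefix u w" if w: "\<forall>k. w k \<in> {1..n}" for w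
  proof -
    have "\<exists>!u. u \<in> L (w 0) \<and> is_prefix u (\<lambda>k. w (Suc k))"
      using w assms[of "w 0"] admissible_ex1[of n "L (w 0)" "\<lambda>k. w (Suc k)"] by blast
    then obtain u where u: "u \<in> L (w 0)" "is_prefix u (\<lambda>k. w (Suc k))"
      and uniq: "\<And>u'. u' \<in> L (w 0) \<Longrightarrow> is_prefix u' (\<lambda>k. w (Suc k)) \<Longrightarrow> u' = u"
      by blast
    show ?thesis
    proof (rule ex1I[of _ "w 0 # u"])
      show "w 0 # u \<in> ?L \<and> is_prefix (w 0 # u) w"
        using u spec[OF w, of 0] by (simp only: is_prefix_Cons) blast
      fix u' assume "u' \<in> ?L \<and> is_prefix u' w"
      then obtain i v where v: "u' = i # v" "v \<in> L i" "is_prefix (i # v) w"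
        by blast
      then have "w 0 = i" "is_prefix v (\<lambda>k. w (Suc k))"
        by (simp_all only: is_prefix_Cons)
      then show "u' = w 0 # u"
        using uniq v by blast
    qed
  qed
  show "admissible n ?L"
    unfolding admissible_def
  proof (intro conjI allI impI ballI)
    show "finite ?L" using fin by auto
    show "word n u" if "u \<in> ?L" for u
      using that words by (auto simp: word_Cons)
  qed (rule ex1)
  have "card ?L = (\<Sum>i\<in>{1..n}. card ((#) i ` L i))"
    using fin by (intro card_UN_disjoint) auto
  then show "card ?L = (\<Sum>i\<in>{1..n}. card (L i))"
    by (simp add: card_image)
qed

text \<open>K counts the inner nodes of the tree: each one replaces a leaf by n leaves. The
  induction hangs the previous tree below letter 1 of a new root and leaves the other children
  bare.\<close>

lemma admissible_card: "\<exists>L. admissible n L \<and> card L = 1 + K * (n - 1)"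
proof (induction K)
  case 0
  then show ?case using admissible_Nil by (intro exI[of _ "{[]}"]) simp
next
  case (Suc K)
  then obtain L where L: "admissible n L" "card L = 1 + K * (n - 1)" by blast
  define L' where "L' i = (if i = 1 then L else {[]})" for i :: nat
  have L': "admissible n (L' i)" for i
    using L admissible_Nil by (simp add: L'_def)
  have "(\<Sum>i\<in>{1..n}. card (L' i)) = card (L' 1) + (\<Sum>i\<in>{1..n}-{1}. card (L' i))"
    using n2 by (intro sum.remove) auto
  also have "(\<Sum>i\<in>{1..n}-{1}. card (L' i)) = n - 1"
    using n2 by (simp add: L'_def)
  finally have "(\<Sum>i\<in>{1..n}. card (L' i)) = 1 + Suc K * (n - 1)"
    using L by (simp add: L'_def)
  then show ?case
    using admissible_glue[of L', OF L'] by (intro exI[of _ "\<Union>i\<in>{1..n}. (#) i ` L' i"]) simp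
qed

text \<open>The path to the leaf u uses \<open>length u\<close> inner nodes, whence the lower bound
  on K; the surplus is spent off the path so that u stays a leaf.\<close>

lemma admissible_card_containing:
  "word n u \<Longrightarrow> u \<noteq> [] \<Longrightarrow> length u \<le> K \<Longrightarrow> \<exists>L. admissible n L \<and> u \<in> L \<and> card L = 1 + K * (n - 1)"
proof (induction u arbitrary: K)
  case (Cons i u)
  from Cons.prems have i: "i \<in> {1..n}" and u: "word n u" by (auto simp: word_Cons)
  from Cons.prems obtain K' where K': "K = Suc K'" by (cases K) auto
  have "\<exists>L. (\<forall>i. admissible n (L i)) \<and> u \<in> L i \<and> (\<Sum>i\<in>{1..n}. card (L i)) = 1 + K * (n - 1)"
  proof (cases "u = []")
    case True
    \<comment> \<open>Since n is at least 2, the last letter of the path has a sibling, below which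
      the remaining \<open>K'\<close> inner nodes are placed.\<close>
    obtain j where j: "j \<in> {1..n}" "j \<noteq> i"
    proof (cases "i = 1")
      case True
      with n2 show ?thesis by (intro that[of 2]) auto
    next
      case False
      with n2 show ?thesis by (intro that[of 1]) auto
    qed
    obtain M where M: "admissible n M" "card M = 1 + K' * (n - 1)" using admissible_card by blast
    define L where "L k = (if k = j then M else {[]})" for k :: nat
    have "(\<Sum>i\<in>{1..n}. card (L i)) = card (L j) + (\<Sum>i\<in>{1..n}-{j}. card (L i))"
      using j by (intro sum.remove) auto
    also have "(\<Sum>i\<in>{1..n}-{j}. card (L i)) = n - 1"
      using j by (simp add: L_def)
    finally show ?thesis
      using M j True admissible_Nil by (intro exI[of _ L]) (auto simp: L_def K')
  next
    case False
    obtain M where M: "admissible n M" "u \<in> M" "card M = 1 + K' * (n - 1)"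
      using Cons.IH[OF u False, of K'] Cons.prems K' by auto
    define L where "L k = (if k = i then M else {[]})" for k :: nat
    have "(\<Sum>i\<in>{1..n}. card (L i)) = card (L i) + (\<Sum>i\<in>{1..n}-{i}. card (L i))"
      using i by (intro sum.remove) auto
    also have "(\<Sum>j\<in>{1..n}-{i}. card (L j)) = n - 1"
      using i by (simp add: L_def)
    finally show ?thesis
      using M i admissible_Nil by (intro exI[of _ L]) (auto simp: L_def K')
  qed
  then obtain L where L: "\<And>i. admissible n (L i)" "u \<in> L i"
    "(\<Sum>i\<in>{1..n}. card (L i)) = 1 + K * (n - 1)" by blast
  show ?case
  proof (rule exI[of _ "\<Union>i\<in>{1..n}. (#) i ` L i"], rule conjI, rule admissible_glue(1)[OF L(1)], rule conjI)
    show "i # u \<in> (\<Union>i\<in>{1..n}. (#) i ` L i)"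
      using i L(2) by blast
    show "card (\<Union>i\<in>{1..n}. (#) i ` L i) = 1 + K * (n - 1)"
      unfolding admissible_glue(2)[OF L(1)] by (rule L(3))
  qed
qed simp

lemma partition_containing:
  assumes "word n u" "u \<noteq> []" "length u \<le> K"
  obtains a where "partition_words a" "length a = Suc (K * (n - 1))" "a ! 0 = u"
proof -
  obtain L where L: "admissible n L" "u \<in> L" "card L = 1 + K * (n - 1)"
    using admissible_card_containing[OF assms] by blast
  from admissible_finite[OF L(1)]
  obtain l where l: "set l = L - {u}" "distinct l"
    using finite_distinct_list[of "L - {u}"] by auto
  have set: "set (u # l) = L" and d: "distinct (u # l)" using l L by auto
  show ?thesis
  proof (rule that[of "u # l"])
    show "partition_words (u # l)" using set d L by (simp only: partition_words_def)
    show "length (u # l) = Suc (K * (n - 1))"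
      using distinct_card[OF d] set L by simp
  qed simp
qed

section \<open>Approximation by the group\<close>

text \<open>Distinct rows have disjoint supports and, within a row, the sources are disjoint, so Cauchy-Schwarz
  in each row bounds the operator norm by the Hilbert-Schmidt norm of the coefficient matrix.\<close>
lemma Eop_matrix_bound:
  fixes c :: "nat \<Rightarrow> nat \<Rightarrow> complex"
  assumes pa: "partition_words a" and pb: "partition_words b"
    and len: "length a = N" "length b = N" and v: "v \<in> l2 X"
  shows "l2norm X (\<lambda>z. \<Sum>j<N. \<Sum>k<N. c j k * Eop (a ! j) (b ! k) v z)
           \<le> sqrt (\<Sum>j<N. \<Sum>k<N. (cmod (c j k))\<^sup>2) * l2norm X v"
proof (rule l2_boundI(2))
  define r where "r j = (\<Sum>k<N. (cmod (c j k))\<^sup>2)" for j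
  define e where "e j k z = Eop (a ! j) (b ! k) v z" for j k z
  define h where "h j k z = ctr n (b ! k) (dil n (a ! j) z)" for j k z
  have wa: "word n (a ! j)" and wb: "word n (b ! j)" if "j < N" for j
    using that len partition_word[OF pa] partition_word[OF pb] by auto
  have Epull: "Eop (a ! j) (b ! k) = pullback X (X \<inter> phi n (a ! j)) (h j k)" if "j < N" "k < N" for j k
    using that wa wb unfolding h_def by (intro Eop_eq_pullback)
  have zero: "e j k z = 0" if "j < N" "k < N" "z \<notin> X \<inter> phi n (a ! j)" for j k z
    using that(3) unfolding e_def Epull[OF that(1,2)] pullback_def by auto
  show "(\<Sum>j<N. \<Sum>k<N. c j k * Eop (a ! j) (b ! k) v y) = 0" if "y \<notin> X" for y
    using zero[of _ _ y] that by (simp add: e_def)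
  have r_nonneg: "0 \<le> r j" for j
    unfolding r_def by (intro sum_nonneg) auto
  have point: "(cmod (\<Sum>j<N. \<Sum>k<N. c j k * e j k z))\<^sup>2 \<le> (\<Sum>j<N. r j * (\<Sum>k<N. (cmod (e j k z))\<^sup>2))"
    (is "_ \<le> ?R") for z
  proof (cases "\<exists>i<N. z \<in> phi n (a ! i)")
    case True
    then obtain i where i: "i < N" "z \<in> phi n (a ! i)" by blast
    have "(\<Sum>k<N. c j k * e j k z) = 0" if "j < N" "j \<noteq> i" for j
    proof -
      have "z \<notin> phi n (a ! j)"
        using partition_disjoint[OF pa, of i j z] that i len by blast
      with that show ?thesis by (simp add: zero)
    qed
    then have "(\<Sum>j<N. \<Sum>k<N. c j k * e j k z) = (\<Sum>j\<in>{i}. \<Sum>k<N. c j k * e j k z)"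
      using i by (intro sum.mono_neutral_right) auto
    then have "cmod (\<Sum>j<N. \<Sum>k<N. c j k * e j k z) \<le> (\<Sum>k<N. \<bar>cmod (c i k)\<bar> * \<bar>cmod (e i k z)\<bar>)"
      using norm_sum[of "\<lambda>k. c i k * e i k z" "{..<N}"] by (simp add: norm_mult)
    also have "\<dots> \<le> L2_set (\<lambda>k. cmod (c i k)) {..<N} * L2_set (\<lambda>k. cmod (e i k z)) {..<N}"
      by (rule L2_set_mult_ineq)
    finally have "(cmod (\<Sum>j<N. \<Sum>k<N. c j k * e j k z))\<^sup>2
        \<le> (L2_set (\<lambda>k. cmod (c i k)) {..<N} * L2_set (\<lambda>k. cmod (e i k z)) {..<N})\<^sup>2"
      by (intro power_mono) auto
    also have "\<dots> = r i * (\<Sum>k<N. (cmod (e i k z))\<^sup>2)"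
      by (simp add: power_mult_distrib L2_set_def r_def sum_nonneg)
    \<comment> \<open>The rows vanishing at z are added back, so that the bound has the same form
      for every z and the sums over z and j can be interchanged.\<close>
    also have "\<dots> \<le> ?R"
      using i by (intro member_le_sum[where f="\<lambda>j. r j * (\<Sum>k<N. (cmod (e j k z))\<^sup>2)"])
        (auto intro!: mult_nonneg_nonneg sum_nonneg r_nonneg)
    finally show ?thesis .
  next
    case False
    then have "e j k z = 0" if "j < N" "k < N" for j k
      using that zero by blast
    then show ?thesis by simp
  qed
  fix F assume F: "finite F" "F \<subseteq> X"
  \<comment> \<open>For fixed j the images \<open>h j k\<close> lie in disjoint source cylinders, so
    the sums over k together account for at most the full norm of v, once.\<close>
  have row: "(\<Sum>k<N. \<Sum>z\<in>F. (cmod (e j k z))\<^sup>2) \<le> (l2norm X v)\<^sup>2" if j: "j < N" for j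
  proof -
    let ?D = "F \<inter> (X \<inter> phi n (a ! j))"
    have sub: "h j k ` ?D \<subseteq> X \<inter> phi n (b ! k)" if "k < N" for k
      using Eop_ctr_dil[OF wa[OF j] wb[OF that]] unfolding h_def by blast
    have "(\<Sum>z\<in>F. (cmod (e j k z))\<^sup>2) = (\<Sum>y\<in>h j k ` ?D. (cmod (v y))\<^sup>2)" if "k < N" for k
      unfolding e_def Epull[OF j that]
    proof (rule sum_norm2_pullback[OF v _ F(1)])
      show "inj_on (h j k) (X \<inter> phi n (a ! j))"
        using n_pos by (auto simp: inj_on_def h_def)
    qed
    then have "(\<Sum>k<N. \<Sum>z\<in>F. (cmod (e j k z))\<^sup>2) = (\<Sum>k<N. \<Sum>y\<in>h j k ` ?D. (cmod (v y))\<^sup>2)"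
      by simp
    also have "\<dots> = (\<Sum>y\<in>(\<Union>k<N. h j k ` ?D). (cmod (v y))\<^sup>2)"
    proof (rule sum.UNION_disjoint[symmetric])
      show "\<forall>i\<in>{..<N}. \<forall>k\<in>{..<N}. i \<noteq> k \<longrightarrow> h j i ` ?D \<inter> h j k ` ?D = {}"
      proof (intro ballI impI)
        fix i k assume ik: "i \<in> {..<N}" "k \<in> {..<N}" "i \<noteq> k"
        then have "phi n (b ! i) \<inter> phi n (b ! k) = {}"
          using partition_disjoint[OF pb, of i k] len by auto
        then show "h j i ` ?D \<inter> h j k ` ?D = {}"
          using sub[of i] sub[of k] ik by blast
      qed
    qed (use F in auto)
    also have "\<dots> \<le> (l2norm X v)\<^sup>2"
      using sub F by (intro sum_norm2_le_l2norm2 v) auto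
    finally show ?thesis .
  qed
  have "(\<Sum>z\<in>F. (cmod (\<Sum>j<N. \<Sum>k<N. c j k * e j k z))\<^sup>2)
      \<le> (\<Sum>z\<in>F. \<Sum>j<N. r j * (\<Sum>k<N. (cmod (e j k z))\<^sup>2))"
    by (intro sum_mono point)
  also have "\<dots> = (\<Sum>j<N. \<Sum>z\<in>F. r j * (\<Sum>k<N. (cmod (e j k z))\<^sup>2))"
    by (rule sum.swap)
  also have "\<dots> = (\<Sum>j<N. r j * (\<Sum>k<N. \<Sum>z\<in>F. (cmod (e j k z))\<^sup>2))"
    by (intro sum.cong refl) (subst sum.swap, simp add: sum_distrib_left)
  also have "\<dots> \<le> (\<Sum>j<N. r j * (l2norm X v)\<^sup>2)"
    by (intro sum_mono mult_left_mono row r_nonneg) auto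
  also have "\<dots> = (\<Sum>j<N. r j) * (l2norm X v)\<^sup>2"
    by (simp add: sum_distrib_right)
  finally have "L2_set (\<lambda>z. cmod (\<Sum>j<N. \<Sum>k<N. c j k * e j k z)) F \<le> sqrt ((\<Sum>j<N. r j) * (l2norm X v)\<^sup>2)"
    unfolding L2_set_def by (rule real_sqrt_le_mono)
  also have "\<dots> = sqrt (\<Sum>j<N. r j) * l2norm X v"
    by (simp add: real_sqrt_mult)
  finally show "L2_set (\<lambda>z. cmod (\<Sum>j<N. \<Sum>k<N. c j k * Eop (a ! j) (b ! k) v z)) F
      \<le> sqrt (\<Sum>j<N. \<Sum>k<N. (cmod (c j k))\<^sup>2) * l2norm X v"
    by (simp only: e_def r_def)
qed

section \<open>The span of the group inside the span of words\<close>

definition word_ops :: "oper set" where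
  "word_ops = {Eop u v | u v. word n u \<and> word n v}"

lemma Eop_word_ops: "word n u \<Longrightarrow> word n v \<Longrightarrow> Eop u v \<in> word_ops"
  unfolding word_ops_def by blast

lemma word_ops_bop: "word_ops \<subseteq> bop X"
  by (auto simp: word_ops_def Eop_bop)

lemma rho_lspan: "g \<in> Vn n \<Longrightarrow> rho n x g \<in> lspan word_ops"
proof -
  assume "g \<in> Vn n"
  then obtain a b where w: "V_witness n g a b" and bij: "bij_betw g {0..<1} {0..<1}"
    by (auto simp: Vn_def)
  have "word n (a ! i)" "word n (b ! i)" if "i < length a" for i
    using that w by (auto simp: V_witness_def intro: admissible_word)
  then have "(\<lambda>v y. \<Sum>i<length a. 1 * Eop (a ! i) (b ! i) v y) \<in> lspan word_ops"
    by (intro lspan_sum lspan_base) (auto simp: word_ops_def)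
  then show ?thesis by (simp add: rho_eq[OF w bij])
qed

abbreviation rho_span :: "oper set" where
  "rho_span \<equiv> lspan (rho n x ` Vn n)"

lemma rho_span_bop: "rho_span \<subseteq> bop X"
  using rho_lspan lspan_bop[OF word_ops_bop] by (intro lspan_bop) auto

text \<open>Exchanging the targets of the words 0 and j changes rho by
  E(j,0) + E(0,j) - E(0,0) - E(j,j). Averaging over j isolates E(0,0) up to a matrix of
  Hilbert-Schmidt norm sqrt(3/M).\<close>
lemma Eop_approx:
  assumes pa: "partition_words a" and pb: "partition_words b"
    and len: "length a = Suc M" "length b = Suc M" and M: "M > 0"
  obtains B where "B \<in> rho_span"
    "\<And>v. v \<in> l2 X \<Longrightarrow> l2norm X (\<lambda>z. Eop (a ! 0) (b ! 0) v z - B v z) \<le> sqrt (3 / real M) * l2norm X v"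
proof -
  define E where "E j k = Eop (a ! j) (b ! k)" for j k
  \<comment> \<open>Only the target list is altered, so every group element involved has the same
    source list b and all matrix units use one pair of partitions.\<close>
  define s where "s m = a[0 := a ! Suc m, Suc m := a ! 0]" for m
  define R0 where "R0 = rho n x (rearrange a b)"
  define R where "R m = rho n x (rearrange (s m) b)" for m
  define B :: oper where "B = (\<lambda>v y. R0 v y + (\<Sum>m<M. (- 1 / of_nat M) * R m v y))"
  \<comment> \<open>The coefficients of E(0,0) - B: 1/M along row 0 and column 0 except the corner,
    and -1/M on the rest of the diagonal. These are 3M entries of modulus 1/M, with square sum
    3/M.\<close>
  define c :: "nat \<Rightarrow> nat \<Rightarrow> complex" where
    "c j k = (if j = 0 then if k = 0 then 0 else 1 / of_nat M
              else if k = 0 then 1 / of_nat M else if j = k then - 1 / of_nat M else 0)" for j k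
  have ps: "partition_words (s m)" "length (s m) = Suc M" if "m < M" for m
  proof -
    have "set (s m) = set a"
      using that len unfolding s_def by (intro set_swap) auto
    moreover have "distinct (s m) = distinct a"
      using that len unfolding s_def by (intro distinct_swap) auto
    ultimately show "partition_words (s m)"
      using pa by (simp add: partition_words_def)
    show "length (s m) = Suc M" by (simp add: s_def len)
  qed
  have R0: "R0 v y = E 0 0 v y + (\<Sum>i<M. E (Suc i) (Suc i) v y)" for v y
    unfolding R0_def rho_rearrange[OF pa pb len(1)[folded len(2)]] len
    by (simp add: E_def sum.lessThan_Suc_shift del: sum.lessThan_Suc)
  have R: "R m v y = E (Suc m) 0 v y + (\<Sum>i<M. E (Suc i) (Suc i) v y) + E 0 (Suc m) v y - E (Suc m) (Suc m) v y"
    if m: "m < M" for m v y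
  proof -
    have "R m v y = (\<Sum>i<Suc M. Eop (s m ! i) (b ! i) v y)"
      unfolding R_def using rho_rearrange[OF ps(1)[OF m] pb] ps(2)[OF m] len by simp
    also have "\<dots> = E (Suc m) 0 v y + (\<Sum>i<M. Eop (s m ! Suc i) (b ! Suc i) v y)"
      using m len by (simp add: sum.lessThan_Suc_shift s_def E_def del: sum.lessThan_Suc)
    \<comment> \<open>Index m is written as its unexchanged term plus a correction, so that the full
      diagonal sum is common to all m.\<close>
    also have "(\<Sum>i<M. Eop (s m ! Suc i) (b ! Suc i) v y)
        = (\<Sum>i<M. E (Suc i) (Suc i) v y + (if i = m then E 0 (Suc m) v y - E (Suc m) (Suc m) v y else 0))"
      using m len by (intro sum.cong) (auto simp: s_def E_def nth_list_update)
    also have "\<dots> = (\<Sum>i<M. E (Suc i) (Suc i) v y) + (E 0 (Suc m) v y - E (Suc m) (Suc m) v y)"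
      using m by (simp add: sum.distrib)
    finally show ?thesis by simp
  qed
  have B: "B \<in> rho_span"
    unfolding B_def
  proof (intro lspan_add lspan_sum)
    show "R0 \<in> rho_span"
      unfolding R0_def using rearrange_Vn(1)[OF pa pb] len by (intro lspan_base) auto
    show "R m \<in> rho_span" if "m \<in> {..<M}" for m
      unfolding R_def using rearrange_Vn(1)[OF ps(1) pb] ps(2) that len by (intro lspan_base) auto
  qed simp
  \<comment> \<open>The common diagonal D enters \<open>R0\<close> once and each of the M operators
    \<open>R m\<close> once with weight -1/M, hence cancels; what remains of it is the correction
    -D/M.\<close>
  have diff: "E 0 0 v y - B v y = (\<Sum>j<Suc M. \<Sum>k<Suc M. c j k * E j k v y)" for v y
  proof -
    define q :: complex where "q = 1 / of_nat M"
    have q: "of_nat M * q = 1" using M by (simp add: q_def)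
    let ?D = "\<Sum>i<M. E (Suc i) (Suc i) v y"
    have "(\<Sum>m<M. (- 1 / of_nat M) * R m v y)
        = (\<Sum>m<M. - q * E (Suc m) 0 v y - q * E 0 (Suc m) v y + q * E (Suc m) (Suc m) v y - q * ?D)"
      by (intro sum.cong) (simp_all add: R q_def field_simps)
    also have "\<dots> = - q * (\<Sum>m<M. E (Suc m) 0 v y) - q * (\<Sum>m<M. E 0 (Suc m) v y) + q * ?D - of_nat M * q * ?D"
      by (simp add: sum.distrib sum_subtractf sum_distrib_left sum_negf mult.assoc)
    finally have "E 0 0 v y - B v y = q * (\<Sum>m<M. E (Suc m) 0 v y) + q * (\<Sum>m<M. E 0 (Suc m) v y) - q * ?D"
      by (simp add: B_def R0 q)
    also have "\<dots> = (\<Sum>j<Suc M. \<Sum>k<Suc M. c j k * E j k v y)"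
    proof -
      have "(\<Sum>k<M. c (Suc j) (Suc k) * E (Suc j) (Suc k) v y) = - q * E (Suc j) (Suc j) v y" if "j < M" for j
      proof -
        have "(\<Sum>k<M. c (Suc j) (Suc k) * E (Suc j) (Suc k) v y)
            = (\<Sum>k<M. if j = k then - q * E (Suc j) (Suc k) v y else 0)"
          by (intro sum.cong) (auto simp: c_def q_def)
        then show ?thesis using that by simp
      qed
      then show ?thesis
        by (simp add: sum.lessThan_Suc_shift sum.distrib c_def[of 0] c_def[of _ 0] q_def[symmetric]
            sum_distrib_left sum_negf del: sum.lessThan_Suc)
    qed
    finally show ?thesis .
  qed
  have "(\<Sum>k<M. (cmod (c (Suc j) (Suc k)))\<^sup>2) = 1 / (real M)\<^sup>2" if "j < M" for j
  proof -
    have "(\<Sum>k<M. (cmod (c (Suc j) (Suc k)))\<^sup>2) = (\<Sum>k<M. if j = k then 1 / (real M)\<^sup>2 else 0)"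
      by (intro sum.cong) (auto simp: c_def norm_divide power_divide)
    then show ?thesis using that by simp
  qed
  then have c: "(\<Sum>j<Suc M. \<Sum>k<Suc M. (cmod (c j k))\<^sup>2) = 3 / real M"
    using M by (simp add: sum.lessThan_Suc_shift sum.distrib c_def[of 0] c_def[of _ 0] norm_divide power_divide
        power2_eq_square del: sum.lessThan_Suc)
  have "l2norm X (\<lambda>z. E 0 0 v z - B v z) \<le> sqrt (3 / real M) * l2norm X v" if "v \<in> l2 X" for v
    using Eop_matrix_bound[OF pa pb len that, of c] unfolding diff c by (simp only: E_def)
  with B show ?thesis
    using that unfolding E_def by blast
qed

lemma Eop_mem_closure_nonempty:
  assumes "word n u" "word n v" "u \<noteq> []" "v \<noteq> []"
  shows "Eop u v \<in> opclosure X rho_span"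
  unfolding opclosure_iff[OF rho_span_bop]
proof (intro conjI allI impI)
  show "Eop u v \<in> bop X" using assms by (intro Eop_bop)
  fix e :: real assume e: "e > 0"
  obtain K0 :: nat where K0: "3 / e\<^sup>2 < real K0" using reals_Archimedean2 by blast
  \<comment> \<open>The same K for both words gives lists of equal length. It exceeds both word
    lengths, as the construction of the languages requires, and \<open>K0\<close> forces 3/M below
    e^2.\<close>
  define K where "K = length u + length v + K0"
  define M where "M = K * (n - 1)"
  have "K * 1 \<le> M" unfolding M_def using n2 by (intro mult_le_mono2) auto
  then have "K \<le> M" by simp
  then have KM: "K0 \<le> M" by (simp add: K_def)
  have M: "M > 0" using \<open>K \<le> M\<close> assms(3) by (cases u) (auto simp: K_def)
  obtain a where a: "partition_words a" "length a = Suc M" "a ! 0 = u"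
    using partition_containing[OF assms(1,3), of K] unfolding M_def K_def by auto
  obtain b where b: "partition_words b" "length b = Suc M" "b ! 0 = v"
    using partition_containing[OF assms(2,4), of K] unfolding M_def K_def by auto
  obtain B where B: "B \<in> rho_span"
    "\<And>f. f \<in> l2 X \<Longrightarrow> l2norm X (\<lambda>z. Eop u v f z - B f z) \<le> sqrt (3 / real M) * l2norm X f"
    using Eop_approx[OF a(1) b(1) a(2) b(2) M] unfolding a(3) b(3) by blast
  have "3 / e\<^sup>2 < real M" using K0 KM by linarith
  then have "3 / real M \<le> e\<^sup>2" using e M by (simp add: field_simps)
  then have "sqrt (3 / real M) \<le> e" using e by (intro real_le_lsqrt) auto
  then have "sqrt (3 / real M) * l2norm X f \<le> e * l2norm X f" for f
    by (intro mult_right_mono) auto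
  then show "\<exists>B\<in>rho_span. \<forall>f\<in>l2 X. l2norm X (\<lambda>y. Eop u v f y - B f y) \<le> e * l2norm X f"
    using B order_trans by (intro bexI[of _ B]) blast+
qed

section \<open>Cuntz relations and products of word operators\<close>

lemma Sword_single: "i \<in> {1..n} \<Longrightarrow> Sword n x [i] = Sop n x i"
  by (simp add: Sword_Cons Sword_Nil comp_idop Sop_bop)

lemma idop_eq_pullback: "idop X = pullback X X (\<lambda>z. z)"
proof
  fix v
  show "idop X v = pullback X X (\<lambda>z. z) v"
    by (cases "v \<in> l2 X") (auto simp: idop_def pullback_def fun_eq_iff intro: l2_zero_off)
qed

text \<open>Cylinders of distinct letters are disjoint, while for equal letters contraction followed
  by dilation is the identity.\<close>

lemma adj_Sop_comp_Sop:
  assumes "i \<in> {1..n}" "j \<in> {1..n}"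
  shows "adj X (Sop n x i) \<circ> Sop n x j = (if i = j then idop X else (\<lambda>v y. 0))"
proof -
  have w: "word n [i]" "word n [j]" using assms by (auto simp: word_Cons)
  have "adj X (Sop n x i) \<circ> Sop n x j = pullback X X (ctr n [i]) \<circ> pullback X (X \<inter> phi n [j]) (dil n [j])"
    using adj_Sword_eq_pullback[OF w(1)] by (simp only: Sword_single[OF assms(1)] Sop_eq_pullback[of j])
  also have "\<dots> = pullback X {z \<in> X. ctr n [i] z \<in> X \<inter> phi n [j]} (dil n [j] \<circ> ctr n [i])"
    by (intro pullback_comp dil_pullback_bop w)
  also have "\<dots> = (if i = j then idop X else (\<lambda>v y. 0))"
  proof (cases "i = j")
    case True
    have "pullback X {z \<in> X. ctr n [j] z \<in> X \<inter> phi n [j]} (dil n [j] \<circ> ctr n [j]) = pullback X X (\<lambda>z. z)"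
    proof (rule pullback_cong)
      show "{z \<in> X. ctr n [j] z \<in> X \<inter> phi n [j]} = X"
        using ctr_orb[OF w(2)] by blast
    qed (simp only: o_apply dil_ctr)
    with True show ?thesis by (simp only: idop_eq_pullback if_True refl)
  next
    case False
    have "phi n [i] \<inter> phi n [j] = {}"
    proof -
      have "i = j" if "z \<in> phi n [i]" "z \<in> phi n [j]" for z
      proof -
        have "real n * z - (real i - 1) \<in> {0..<1}" "real n * z - (real j - 1) \<in> {0..<1}"
          using that by (simp_all only: mem_phi_Cons phi_Nil)
        then have "real i < real j + 1" "real j < real i + 1"
          unfolding atLeastLessThan_iff by linarith+
        then show ?thesis by linarith
      qed
      with False show ?thesis by blast
    qed
    then have "{z \<in> X. ctr n [i] z \<in> X \<inter> phi n [j]} = {}"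
      using ctr_orb[OF w(1)] by blast
    with False show ?thesis by (simp only: if_False) (simp add: pullback_def fun_eq_iff)
  qed
  finally show ?thesis .
qed

lemma Sword_append: "word n u \<Longrightarrow> word n w \<Longrightarrow> Sword n x (u @ w) = Sword n x u \<circ> Sword n x w"
  by (induction u) (simp_all add: Sword_Nil Sword_Cons idop_comp Sword_bop word_Cons comp_assoc)

lemma adj_Sword_Cons:
  assumes "i \<in> {1..n}" "word n u"
  shows "adj X (Sword n x (i # u)) = adj X (Sword n x u) \<circ> adj X (Sop n x i)"
  unfolding Sword_Cons using assms by (intro adj_comp Sop_bop Sword_bop)

text \<open>Equal leading letters cancel in pairs. Either a mismatch gives zero, or one word is
  exhausted and the tail of the other remains, as itself or as an adjoint.\<close>

lemma adj_Sword_comp_Sword: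
  "word n v \<Longrightarrow> word n u \<Longrightarrow> adj X (Sword n x v) \<circ> Sword n x u = (\<lambda>f y. 0)
     \<or> (\<exists>w. word n w \<and> adj X (Sword n x v) \<circ> Sword n x u = Sword n x w)
     \<or> (\<exists>w. word n w \<and> adj X (Sword n x v) \<circ> Sword n x u = adj X (Sword n x w))"
proof (induction v arbitrary: u)
  case Nil
  then have "adj X (Sword n x []) \<circ> Sword n x u = Sword n x u"
    by (simp add: Sword_Nil adj_idop idop_comp Sword_bop)
  with Nil show ?case by blast
next
  case (Cons i v)
  show ?case
  proof (cases u)
    case Nil
    then have "adj X (Sword n x (i # v)) \<circ> Sword n x u = adj X (Sword n x (i # v))"
      using Cons.prems by (simp add: Sword_Nil comp_idop adj_bop Sword_bop)
    with Cons.prems show ?thesis by blast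
  next
    case (Cons j u')
    have ij: "i \<in> {1..n}" "j \<in> {1..n}" and w: "word n v" "word n u'"
      using Cons.prems Cons by (auto simp: word_Cons)
    have "adj X (Sword n x (i # v)) \<circ> Sword n x u
        = adj X (Sword n x v) \<circ> ((adj X (Sop n x i) \<circ> Sop n x j) \<circ> Sword n x u')"
      unfolding Cons adj_Sword_Cons[OF ij(1) w(1)] Sword_Cons[of j u'] by (simp only: comp_assoc)
    also have "\<dots> = (if i = j then adj X (Sword n x v) \<circ> Sword n x u' else (\<lambda>f y. 0))"
      unfolding adj_Sop_comp_Sop[OF ij]
      using bop_zero_vec[OF adj_bop[OF Sword_bop[OF w(1)]]]
      by (cases "i = j") (simp add: idop_comp Sword_bop w, simp add: o_def)
    finally show ?thesis
      using Cons.IH[OF w] by (cases "i = j") simp_all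
  qed
qed

lemma adj_Eop: "word n u \<Longrightarrow> word n v \<Longrightarrow> adj X (Eop u v) = Eop v u"
  unfolding Eop_def by (simp add: adj_comp adj_adj adj_bop Sword_bop)

text \<open>The middle factor S_v^* S_u' reduces to a single word or its adjoint, which is absorbed
  by lengthening u or v', or it kills the product.\<close>

lemma Eop_comp_lspan:
  assumes "word n u" "word n v" "word n u'" "word n v'"
  shows "Eop u v \<circ> Eop u' v' \<in> lspan word_ops"
proof -
  let ?m = "adj X (Sword n x v) \<circ> Sword n x u'"
  have eq: "Eop u v \<circ> Eop u' v' = Sword n x u \<circ> ?m \<circ> adj X (Sword n x v')"
    by (simp only: Eop_def comp_assoc)
  consider "?m = (\<lambda>f y. 0)" | w where "word n w" "?m = Sword n x w"
    | w where "word n w" "?m = adj X (Sword n x w)"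
    using adj_Sword_comp_Sword[OF assms(2,3)] by blast
  then show ?thesis
  proof cases
    case 1
    have "Eop u v \<circ> Eop u' v' = (\<lambda>f y. 0)"
      unfolding eq 1 using bop_zero_vec[OF Sword_bop[OF assms(1)]] by (simp add: o_def)
    then show ?thesis by (simp only: lspan_zero)
  next
    case (2 w)
    have "Eop u v \<circ> Eop u' v' = Eop (u @ w) v'"
      unfolding eq 2 by (simp only: Eop_def Sword_append[OF assms(1) 2(1)])
    then show ?thesis
      using assms 2(1) by (simp add: lspan_base Eop_word_ops word_append)
  next
    case (3 w)
    have "Eop u v \<circ> Eop u' v' = Eop u (v' @ w)"
      unfolding eq 3
      by (simp only: Eop_def Sword_append[OF assms(4) 3(1)] comp_assoc
          adj_comp[OF Sword_bop[OF assms(4)] Sword_bop[OF 3(1)]])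
    then show ?thesis
      using assms 3(1) by (simp add: lspan_base Eop_word_ops word_append)
  qed
qed

lemma Sop_lspan: "i \<in> {1..n} \<Longrightarrow> Sop n x i \<in> lspan word_ops"
proof -
  assume i: "i \<in> {1..n}"
  then have "Sop n x i = Eop [i] []"
    unfolding Eop_def Sword_single[OF i] Sword_Nil adj_idop by (simp only: comp_idop Sop_bop)
  moreover have "Eop [i] [] \<in> word_ops"
    using i by (intro Eop_word_ops) (auto simp: word_Cons)
  ultimately show ?thesis by (simp only: lspan_base)
qed

lemma cstar_gen_subset: "cstar_gen X (Sop n x ` {1..n}) \<subseteq> opclosure X (lspan word_ops)"
proof (rule cstar_gen_subset_opclosure_lspan[OF word_ops_bop])
  show "Sop n x ` {1..n} \<subseteq> lspan word_ops"
    using Sop_lspan by blast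
  show "B \<circ> C \<in> lspan word_ops" if "B \<in> word_ops" "C \<in> word_ops" for B C
  proof -
    obtain u v u' v' where "B = Eop u v" "C = Eop u' v'" "word n u" "word n v" "word n u'" "word n v'"
      using \<open>B \<in> word_ops\<close> \<open>C \<in> word_ops\<close> unfolding word_ops_def by blast
    then show ?thesis by (simp only: Eop_comp_lspan)
  qed
  show "adj X B \<in> lspan word_ops" if "B \<in> word_ops" for B
  proof -
    obtain u v where uv: "B = Eop u v" "word n u" "word n v"
      using \<open>B \<in> word_ops\<close> unfolding word_ops_def by blast
    then have "adj X B \<in> word_ops"
      by (auto simp: word_ops_def adj_Eop)
    then show ?thesis by (rule lspan_base)
  qed
qed

text \<open>The Cuntz relation for the range projections: the one-letter cylinders tile [0,1[, so
  each coordinate survives only in the summand of its first digit.\<close>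

lemma idop_eq_sum_Eop: "idop X = (\<lambda>f z. \<Sum>i\<in>{1..n}. 1 * Eop [i] [i] f z)"
proof (intro ext)
  fix f z
  have E: "Eop [i] [i] f z = (if f \<in> l2 X \<and> z \<in> X \<and> i = dig z 0 then f z else 0)" if "i \<in> {1..n}" for i
  proof -
    have w: "word n [i]" using that by (auto simp: word_Cons)
    have "z \<in> phi n [i] \<longleftrightarrow> i = dig z 0" if "z \<in> X"
      using mem_phi_iff_prefix[OF w orb_subset[OF that]] by (auto simp: is_prefix_Cons)
    then show ?thesis
      unfolding Eop_eq_pullback[OF w w] pullback_def ctr_dil by auto
  qed
  then have "(\<Sum>i\<in>{1..n}. 1 * Eop [i] [i] f z)
      = (\<Sum>i\<in>{1..n}. if f \<in> l2 X \<and> z \<in> X \<and> i = dig z 0 then f z else 0)"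
    by (intro sum.cong) auto
  also have "\<dots> = idop X f z"
  proof (cases "f \<in> l2 X \<and> z \<in> X")
    case True
    then show ?thesis
      using dig_mem[OF orb_subset, of z 0] by (simp add: idop_def)
  next
    case False
    then show ?thesis
      using l2_zero_off by (auto simp: idop_def)
  qed
  finally show "idop X f z = (\<Sum>i\<in>{1..n}. 1 * Eop [i] [i] f z)" ..
qed

text \<open>The resolution of the identity is inserted between S_u and S_v^*. Both words gain a
  letter and thus become nonempty.\<close>

lemma Eop_split:
  assumes "word n u" "word n v"
  shows "Eop u v = (\<lambda>f z. \<Sum>i\<in>{1..n}. 1 * Eop (u @ [i]) (v @ [i]) f z)"
proof
  fix f
  have w: "word n [i]" if "i \<in> {1..n}" for i using that by (auto simp: word_Cons)
  have split: "Eop (u @ [i]) (v @ [i]) = Sword n x u \<circ> (Eop [i] [i] \<circ> adj X (Sword n x v))" if "i \<in> {1..n}" for i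
    unfolding Eop_def Sword_append[OF assms(1) w[OF that]] Sword_append[OF assms(2) w[OF that]]
      adj_comp[OF Sword_bop[OF assms(2)] Sword_bop[OF w[OF that]]] by (simp only: comp_assoc)
  let ?g = "adj X (Sword n x v) f"
  show "Eop u v f = (\<lambda>z. \<Sum>i\<in>{1..n}. 1 * Eop (u @ [i]) (v @ [i]) f z)"
  proof (cases "f \<in> l2 X")
    case True
    then have g: "?g \<in> l2 X" using bop_l2[OF adj_bop[OF Sword_bop[OF assms(2)]]] by blast
    have "Eop u v f = Sword n x u (idop X ?g)"
      using g by (simp add: Eop_def idop_def)
    also have "\<dots> = Sword n x u (\<lambda>z. \<Sum>i\<in>{1..n}. 1 * Eop [i] [i] ?g z)"
      unfolding idop_eq_sum_Eop ..
    also have "\<dots> = (\<lambda>z. \<Sum>i\<in>{1..n}. 1 * Sword n x u (Eop [i] [i] ?g) z)"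
      using Eop_bop[OF w w] g by (intro bop_sum_vec[OF Sword_bop[OF assms(1)]]) (auto intro: bop_l2)
    also have "\<dots> = (\<lambda>z. \<Sum>i\<in>{1..n}. 1 * Eop (u @ [i]) (v @ [i]) f z)"
      by (intro ext sum.cong refl) (simp only: split o_apply)
    finally show ?thesis .
  next
    case False
    have "Eop (u @ [i]) (v @ [i]) f = (\<lambda>_. 0)" if "i \<in> {1..n}" for i
      using False assms w[OF that] by (intro bop_ext[OF Eop_bop]) (auto simp: word_append)
    moreover have "Eop u v f = (\<lambda>_. 0)"
      using False assms by (intro bop_ext[OF Eop_bop])
    ultimately show ?thesis by simp
  qed
qed

section \<open>The two inclusions\<close>

lemma rho_bop: "rho n x ` Vn n \<subseteq> bop X"
  using rho_lspan lspan_bop[OF word_ops_bop] by blast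

lemma word_ops_closure: "word_ops \<subseteq> opclosure X rho_span"
proof
  fix T assume "T \<in> word_ops"
  then obtain u v where uv: "T = Eop u v" "word n u" "word n v"
    unfolding word_ops_def by blast
  define B where "B = (\<lambda>i. Eop (u @ [i]) (v @ [i])) ` {1..n}"
  have "B \<subseteq> opclosure X rho_span"
    unfolding B_def using uv(2,3)
    by (auto intro!: Eop_mem_closure_nonempty simp: word_append word_Cons)
  then have "lspan B \<subseteq> opclosure X rho_span"
    by (rule opclosure_lspan_subset[OF rho_bop])
  moreover have "T \<in> lspan B"
    unfolding uv(1) Eop_split[OF uv(2,3)] by (intro lspan_sum lspan_base) (auto simp: B_def)
  ultimately show "T \<in> opclosure X rho_span" by blast
qed

lemma opclosure_word_ops: "opclosure X (lspan word_ops) \<subseteq> opclosure X rho_span"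
  using opclosure_mono[OF opclosure_lspan_subset[OF rho_bop word_ops_closure]]
    opclosure_idem[OF rho_span_bop] by blast

text \<open>Every algebra in the intersection contains all E(u,v), hence all
  \<open>rho n x g\<close> and their closed span.\<close>

lemma opclosure_rho_span_subset: "opclosure X rho_span \<subseteq> cstar_gen X (Sop n x ` {1..n})"
  unfolding cstar_gen_def
proof (rule Inter_greatest)
  fix A
  assume "A \<in> {A. Sop n x ` {1..n} \<subseteq> A \<and> A \<subseteq> bop X
      \<and> (\<forall>S\<in>A. \<forall>T\<in>A. (\<lambda>v y. S v y + T v y) \<in> A)
      \<and> (\<forall>S\<in>A. \<forall>c::complex. (\<lambda>v y. c * S v y) \<in> A)
      \<and> (\<forall>S\<in>A. \<forall>T\<in>A. S \<circ> T \<in> A)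
      \<and> (\<forall>S\<in>A. adj X S \<in> A)
      \<and> opclosure X A \<subseteq> A}"
  then have gen: "Sop n x ` {1..n} \<subseteq> A"
    and add: "\<And>S T. S \<in> A \<Longrightarrow> T \<in> A \<Longrightarrow> (\<lambda>v y. S v y + T v y) \<in> A"
    and scale: "\<And>S c. S \<in> A \<Longrightarrow> (\<lambda>v y. c * S v y) \<in> A"
    and comp: "\<And>S T. S \<in> A \<Longrightarrow> T \<in> A \<Longrightarrow> S \<circ> T \<in> A"
    and adj: "\<And>S. S \<in> A \<Longrightarrow> adj X S \<in> A"
    and closed: "opclosure X A \<subseteq> A"
    by blast+
  have S: "Sop n x i \<in> A" if "i \<in> {1..n}" for i
    using gen that by blast
  have zero: "(\<lambda>v y. 0) \<in> A"
    using scale[OF S[of 1], of 0] n2 by simp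
  have span: "lspan G \<subseteq> A" if "G \<subseteq> A" for G
    by (rule lspan_minimal[OF that zero add scale])
  \<comment> \<open>The competing algebras are not assumed unital. The identity, from which
    \<open>Sword\<close> starts, is recovered as the sum of the S_i S_i^*.\<close>
  have "idop X \<in> A"
  proof -
    define G where "G = (\<lambda>i. Eop [i] [i]) ` {1..n}"
    have "Eop [i] [i] \<in> A" if "i \<in> {1..n}" for i
      unfolding Eop_def Sword_single[OF that] by (intro comp adj S that)
    then have "lspan G \<subseteq> A"
      unfolding G_def by (intro span) blast
    moreover have "idop X \<in> lspan G"
      unfolding idop_eq_sum_Eop by (intro lspan_sum lspan_base) (auto simp: G_def)
    ultimately show ?thesis by blast
  qed
  then have Sw: "Sword n x u \<in> A" if "word n u" for u
    using that by (induction u) (auto simp: Sword_Nil Sword_Cons word_Cons intro!: comp S)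
  have "word_ops \<subseteq> A"
    unfolding word_ops_def Eop_def using Sw comp adj by blast
  then have "lspan word_ops \<subseteq> A"
    by (rule span)
  then have "rho_span \<subseteq> A"
    using rho_lspan by (intro span) blast
  then show "opclosure X rho_span \<subseteq> A"
    using opclosure_mono closed by blast
qed

end

theorem theorem4p10:
  fixes n :: nat and x :: real
  assumes "n \<ge> 2" and "0 \<le> x" and "x < 1"
  shows "opclosure (orb n x) (lspan (rho n x ` Vn n))
           = cstar_gen (orb n x) (Sop n x ` {1..n})"
proof -
  interpret cuntz n x
    using assms(1) by unfold_locales
  show ?thesis
    using opclosure_rho_span_subset cstar_gen_subset opclosure_word_ops by blast
qed

end
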